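(* Let $\alpha=(\alpha_n)_{n\in\mathbb N}$ be a positive, strictly increasing sequence with $\alpha_n\to\infty$, and let $\mathsf C\in\mathcal L(E_\alpha)$ be the Cesàro operator. The following assertions are equivalent. (i) $E_\alpha$ is nuclear. (ii) $\sigma(\mathsf C;E_\alpha)=\sigma_{pt}(\mathsf C;E_\alpha)$. (iii) $\sigma(\mathsf C;E_\alpha)=\{\frac1n:n\in\mathbb N\}$.
   Context: $\mathbb N=\{1,2,3,\dots\}$. For a strictly positive sequence $w$ on $\mathbb N$, $c_0(w)=\{x\in\mathbb C^{\mathbb N}: \lim_{n\to\infty} w(n)|x_n|=0\}$, a Banach space with norm $\sup_n w(n)|x_n|$. Given $\alpha$, fix a strictly increasing sequence $(s_k)_{k\in\mathbb N}\subset(1,\infty)$ with $s_k\to\infty$ and put $v_k(n):=s_k^{-\alpha_n}$. Define $E_\alpha:=\mathrm{ind}_k\, c_0(v_k)$, i.e. $E_\alpha=\bigcup_k c_0(v_k)\subseteq\mathbb C^{\mathbb N}$ endowed with the finest locally convex Hausdorff topology making all inclusions $c_0(v_k)\hookrightarrow E_\alpha$ continuous; $E_\alpha$ does not depend on the choice of $(s_k)$. It is known that $E_\alpha$ is nuclear if and only if $\sup_n\frac{\log n}{\alpha_n}<\infty$. The Cesàro operator is $\mathsf Cx=\left(\frac{x_1+\dots+x_n}{n}\right)_{n\in\mathbb N}$, and it belongs to $\mathcal L(E_\alpha)$ (continuous linear operators from $E_\alpha$ into itself). For $T\in\mathcal L(X)$: $\rho(T;X)$ is the set of $\lambda\in\mathbb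 C$ such that $(\lambda I-T)^{-1}$ exists in $\mathcal L(X)$; $\sigma(T;X)=\mathbb C\setminus\rho(T;X)$; $\sigma_{pt}(T;X)$ is the set of $\lambda$ for which $\lambda I-T$ is not injective. *)

theory Defs
  imports "HOL-Analysis.Analysis" "HOL-Library.Function_Algebras"
begin

section \<open>Complex vector spaces\<close>

class complex_vector = ab_group_add +
  fixes scaleC :: "complex \<Rightarrow> 'a \<Rightarrow> 'a" (infixr \<open>*\<^sub>C\<close> 75)
  assumes scaleC_right_distrib: "c *\<^sub>C (x + y) = c *\<^sub>C x + c *\<^sub>C y"
    and scaleC_left_distrib: "(c + d) *\<^sub>C x = c *\<^sub>C x + d *\<^sub>C x"
    and scaleC_scaleC: "c *\<^sub>C (d *\<^sub>C x) = (c * d) *\<^sub>C x"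
    and scaleC_one: "1 *\<^sub>C x = x"

global_interpretation complex_vector: vector_space "scaleC :: complex \<Rightarrow> 'a \<Rightarrow> 'a::complex_vector"
  by standard (fact scaleC_right_distrib scaleC_left_distrib scaleC_scaleC scaleC_one)+

instantiation complex :: complex_vector
begin
definition scaleC_complex :: "complex \<Rightarrow> complex \<Rightarrow> complex" where "scaleC_complex = (*)"
instance by standard (auto simp: scaleC_complex_def algebra_simps)
end

instantiation "fun" :: (type, complex_vector) complex_vector
begin
definition scaleC_fun :: "complex \<Rightarrow> ('a \<Rightarrow> 'b) \<Rightarrow> 'a \<Rightarrow> 'b" where "scaleC_fun c f = (\<lambda>x. c *\<^sub>C f x)"
instance
  by standard
    (auto simp: scaleC_fun_def scaleC_right_distrib scaleC_left_distrib scaleC_scaleC scaleC_one)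
end

abbreviation csubspace :: "'v::complex_vector set \<Rightarrow> bool" where
  "csubspace \<equiv> complex_vector.subspace"

definition linear_map_on :: "'v set \<Rightarrow> ('v::complex_vector \<Rightarrow> 'w::complex_vector) \<Rightarrow> bool" where
  "linear_map_on E f \<longleftrightarrow>
     (\<forall>x\<in>E. \<forall>y\<in>E. f (x + y) = f x + f y) \<and> (\<forall>c. \<forall>x\<in>E. f (c *\<^sub>C x) = c *\<^sub>C f x)"

definition seminorm_on :: "'v::complex_vector set \<Rightarrow> ('v \<Rightarrow> real) \<Rightarrow> bool" where
  "seminorm_on E p \<longleftrightarrow>
     (\<forall>x\<in>E. 0 \<le> p x) \<and> (\<forall>x\<in>E. \<forall>y\<in>E. p (x + y) \<le> p x + p y) \<and>
     (\<forall>c. \<forall>x\<in>E. p (c *\<^sub>C x) = cmod c * p x)"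

definition cconvex :: "'v::complex_vector set \<Rightarrow> bool" where
  "cconvex S \<longleftrightarrow> (\<forall>x\<in>S. \<forall>y\<in>S. \<forall>t\<in>{0..1::real}. of_real t *\<^sub>C x + of_real (1 - t) *\<^sub>C y \<in> S)"

section \<open>Locally convex spaces\<close>

text \<open>A locally convex space is given by its topology \<open>T\<close>; the underlying vector space is the
  subspace \<open>topspace T\<close> of the ambient type.\<close>

definition locally_convex :: "'v::complex_vector topology \<Rightarrow> bool" where
  "locally_convex T \<longleftrightarrow>
     csubspace (topspace T) \<and>
     continuous_map (prod_topology T T) T (\<lambda>(x, y). x + y) \<and>
     continuous_map (prod_topology euclidean T) T (\<lambda>(c, x). c *\<^sub>C x) \<and>
     (\<forall>U. openin T U \<and> 0 \<in> U \<longrightarrow> (\<exists>V. openin T V \<and> 0 \<in> V \<and> V \<subseteq> U \<and> cconvex V))"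

definition ind_admissible :: "('k \<Rightarrow> 'v::complex_vector topology) \<Rightarrow> 'v topology \<Rightarrow> bool" where
  "ind_admissible G T \<longleftrightarrow>
     topspace T = (\<Union>k. topspace (G k)) \<and> locally_convex T \<and> Hausdorff_space T \<and>
     (\<forall>k. continuous_map (G k) T (\<lambda>x. x))"

text \<open>The least upper bound of the admissible topologies; by \<open>ind_topology_finest\<close> it is itself
  admissible as soon as an admissible topology exists, i.e. it is then the finest locally convex
  Hausdorff topology making the inclusions of the steps continuous.\<close>

definition ind_topology :: "('k \<Rightarrow> 'v::complex_vector topology) \<Rightarrow> 'v topology" where
  "ind_topology G = topology_generated_by {U. \<exists>T. ind_admissible G T \<and> openin T U}"

lemma ind_topology_openin:
  assumes "ind_admissible G T" "openin T U"
  shows "openin (ind_topology G) U"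
  unfolding ind_topology_def using assms by (intro topology_generated_by_Basis) blast

lemma ind_topology_finest:
  assumes "ind_admissible G T0"
  shows "ind_admissible G (ind_topology G)"
    and "\<And>T U. ind_admissible G T \<Longrightarrow> openin T U \<Longrightarrow> openin (ind_topology G) U"
proof -
  let ?S = "ind_topology G" and ?E = "\<Union>k. topspace (G k)"
  have topE: "topspace T = ?E" if "ind_admissible G T" for T
    using that by (simp add: ind_admissible_def)
  have topS: "topspace ?S = ?E"
  proof
    show "topspace ?S \<subseteq> ?E"
      unfolding ind_topology_def topology_generated_by_topspace
    proof (rule Union_least)
      fix U assume "U \<in> {U. \<exists>T. ind_admissible G T \<and> openin T U}"
      then obtain T where "ind_admissible G T" "openin T U" by auto
      then show "U \<subseteq> ?E" using openin_subset[of T U] topE[of T] by simp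
    qed
    show "?E \<subseteq> topspace ?S"
      using openin_subset[OF ind_topology_openin[OF assms openin_topspace]] topE[OF assms] by simp
  qed
  have idc: "continuous_map ?S T (\<lambda>x. x)" if T: "ind_admissible G T" for T
  proof -
    have "openin ?S {x \<in> topspace ?S. x \<in> U}" if U: "openin T U" for U
    proof -
      have "{x \<in> topspace ?S. x \<in> U} = U"
        using openin_subset[OF U] unfolding topS topE[OF T] by (simp add: subset_iff set_eq_iff) blast
      then show ?thesis using ind_topology_openin[OF T U] by simp
    qed
    moreover have "topspace ?S = topspace T" using topS topE[OF T] by simp
    ultimately show ?thesis by (simp add: continuous_map_def)
  qed
  have into: "continuous_map X ?S f"
    if f: "\<And>T. ind_admissible G T \<Longrightarrow> continuous_map X T f" for X :: "'c topology" and f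
    unfolding ind_topology_def
  proof (subst continuous_on_generated_topo_iff, intro conjI allI impI)
    fix U assume "U \<in> {U. \<exists>T. ind_admissible G T \<and> openin T U}"
    then obtain T where T: "ind_admissible G T" "openin T U" by blast
    have "openin X {x \<in> topspace X. f x \<in> U}"
      using f[OF T(1)] T(2) by (auto simp: continuous_map_def)
    moreover have "f -` U \<inter> topspace X = {x \<in> topspace X. f x \<in> U}" by auto
    ultimately show "openin X (f -` U \<inter> topspace X)" by simp
  next
    show "f ` topspace X \<subseteq> \<Union> {U. \<exists>T. ind_admissible G T \<and> openin T U}"
      by (rule order_trans[OF continuous_map_image_subset_topspace[OF f[OF assms]]], rule Union_upper)
        (use assms openin_topspace in auto)
  qed
  have add: "continuous_map (prod_topology ?S ?S) ?S (\<lambda>(x, y). x + y)"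
  proof (rule into)
    fix T assume T: "ind_admissible G T"
    have c1: "continuous_map (prod_topology ?S ?S) (prod_topology T T) (\<lambda>(x, y). (x, y))"
      using idc[OF T] continuous_map_prod_top[of ?S ?S T T "\<lambda>x. x" "\<lambda>x. x"] by simp
    have c2: "continuous_map (prod_topology T T) T (\<lambda>(x, y). x + y)"
      using T by (simp add: ind_admissible_def locally_convex_def)
    show "continuous_map (prod_topology ?S ?S) T (\<lambda>(x, y). x + y)"
      using continuous_map_compose[OF c1 c2] by (simp add: o_def case_prod_unfold)
  qed
  have scale: "continuous_map (prod_topology euclidean ?S) ?S (\<lambda>(c, x). c *\<^sub>C x)"
  proof (rule into)
    fix T assume T: "ind_admissible G T"
    have c1: "continuous_map (prod_topology euclidean ?S) (prod_topology (euclidean :: complex topology) T)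
            (\<lambda>(x, y). (x, y))"
      using idc[OF T] continuous_map_prod_top[of euclidean ?S euclidean T "\<lambda>x. x" "\<lambda>x. x"] by simp
    have c2: "continuous_map (prod_topology euclidean T) T (\<lambda>(c, x). c *\<^sub>C x)"
      using T by (simp add: ind_admissible_def locally_convex_def)
    show "continuous_map (prod_topology euclidean ?S) T (\<lambda>(c, x). c *\<^sub>C x)"
      using continuous_map_compose[OF c1 c2] by (simp add: o_def case_prod_unfold)
  qed
  have conv: "\<exists>V. openin ?S V \<and> 0 \<in> V \<and> V \<subseteq> U \<and> cconvex V"
    if "openin ?S U" "0 \<in> U" for U
  proof -
    from that(1) have "generate_topology_on {U. \<exists>T. ind_admissible G T \<and> openin T U} U"
      by (simp add: ind_topology_def openin_topology_generated_by_iff)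
    then show ?thesis using that(2)
    proof (induction rule: generate_topology_on.induct)
      case Empty
      then show ?case by simp
    next
      case (Int A B)
      then obtain V W where "openin ?S V" "0 \<in> V" "V \<subseteq> A" "cconvex V"
        "openin ?S W" "0 \<in> W" "W \<subseteq> B" "cconvex W" by auto
      then show ?case by (intro exI[of _ "V \<inter> W"]) (auto simp: cconvex_def)
    next
      case (UN K)
      then obtain A where A: "A \<in> K" "0 \<in> A" by auto
      then obtain V where "openin ?S V" "0 \<in> V" "V \<subseteq> A" "cconvex V"
        using UN.IH[OF A] by auto
      then show ?case using A by (intro exI[of _ V]) auto
    next
      case (Basis A)
      then obtain T where T: "ind_admissible G T" "openin T A" by blast
      then obtain V where "openin T V" "0 \<in> V" "V \<subseteq> A" "cconvex V"
        using Basis.prems by (auto simp: ind_admissible_def locally_convex_def)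
      then show ?case using ind_topology_openin[OF T(1)] by metis
    qed
  qed
  have haus: "Hausdorff_space ?S"
    unfolding Hausdorff_space_def
  proof (intro allI impI, goal_cases)
    case (1 x y)
    then have "x \<in> topspace T0" "y \<in> topspace T0" "x \<noteq> y"
      using topS topE[OF assms] by auto
    moreover have "Hausdorff_space T0" using assms by (simp add: ind_admissible_def)
    ultimately obtain U V where "openin T0 U" "openin T0 V" "x \<in> U" "y \<in> V" "disjnt U V"
      unfolding Hausdorff_space_def by metis
    then show ?case using ind_topology_openin[OF assms] by metis
  qed
  have sub: "csubspace (topspace ?S)"
    using assms topS topE[OF assms] by (simp add: ind_admissible_def locally_convex_def)
  have incl: "continuous_map (G k) ?S (\<lambda>x. x)" for k
    by (rule into) (simp add: ind_admissible_def)
  show "ind_admissible G ?S"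
    using topS add scale conv haus sub incl unfolding ind_admissible_def locally_convex_def by blast
  show "\<And>T U. ind_admissible G T \<Longrightarrow> openin T U \<Longrightarrow> openin ?S U"
    by (rule ind_topology_openin)
qed

definition cont_lin_ops :: "'v::complex_vector topology \<Rightarrow> ('v \<Rightarrow> 'v) set" where
  "cont_lin_ops T = {S. linear_map_on (topspace T) S \<and> continuous_map T T S}"

definition resolvent_set :: "'v::complex_vector topology \<Rightarrow> ('v \<Rightarrow> 'v) \<Rightarrow> complex set" where
  "resolvent_set T A = {\<mu>. \<exists>R\<in>cont_lin_ops T. \<forall>x\<in>topspace T.
      R (\<mu> *\<^sub>C x - A x) = x \<and> \<mu> *\<^sub>C R x - A (R x) = x}"

definition spectrum :: "'v::complex_vector topology \<Rightarrow> ('v \<Rightarrow> 'v) \<Rightarrow> complex set" where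
  "spectrum T A = UNIV - resolvent_set T A"

definition point_spectrum :: "'v::complex_vector topology \<Rightarrow> ('v \<Rightarrow> 'v) \<Rightarrow> complex set" where
  "point_spectrum T A = {\<mu>. \<not> inj_on (\<lambda>x. \<mu> *\<^sub>C x - A x) (topspace T)}"

section \<open>Nuclear spaces\<close>

text \<open>Nuclear maps between seminormed spaces \<open>(X, q)\<close> and \<open>(Y, p)\<close>; a seminormed space stands for
  the normed space obtained by dividing out the kernel of the seminorm.\<close>

definition nuclear_map_on ::
  "'v::complex_vector set \<Rightarrow> ('v \<Rightarrow> real) \<Rightarrow> 'w::complex_vector set \<Rightarrow> ('w \<Rightarrow> real) \<Rightarrow> ('v \<Rightarrow> 'w) \<Rightarrow> bool"
  where
  "nuclear_map_on X q Y p f \<longleftrightarrow>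
     (\<exists>(l :: nat \<Rightarrow> complex) (a :: nat \<Rightarrow> 'v \<Rightarrow> complex) (y :: nat \<Rightarrow> 'w).
        summable (\<lambda>j. cmod (l j)) \<and>
        (\<forall>j. linear_map_on X (a j) \<and> (\<forall>x\<in>X. cmod (a j x) \<le> q x)) \<and>
        (\<forall>j. y j \<in> Y \<and> p (y j) \<le> 1) \<and>
        (\<forall>x\<in>X. (\<lambda>N. p (f x - (\<Sum>j<N. (l j * a j x) *\<^sub>C y j))) \<longlonglongrightarrow> 0))"

text \<open>The local Banach space of a seminorm \<open>p\<close> is the completion of \<open>E / ker p\<close>, realised by the
  \<open>p\<close>-Cauchy sequences in \<open>E\<close> under the limit of \<open>p\<close> (modulo its kernel).\<close>

definition cauchy_seqs :: "'v::complex_vector set \<Rightarrow> ('v \<Rightarrow> real) \<Rightarrow> (nat \<Rightarrow> 'v) set" where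
  "cauchy_seqs E p =
     {\<xi>. (\<forall>m. \<xi> m \<in> E) \<and> (\<forall>e>0. \<exists>M. \<forall>m\<ge>M. \<forall>n\<ge>M. p (\<xi> m - \<xi> n) < e)}"

definition completed_seminorm :: "('v \<Rightarrow> real) \<Rightarrow> (nat \<Rightarrow> 'v) \<Rightarrow> real" where
  "completed_seminorm p \<xi> = lim (\<lambda>m. p (\<xi> m))"

definition continuous_seminorm :: "'v::complex_vector topology \<Rightarrow> ('v \<Rightarrow> real) \<Rightarrow> bool" where
  "continuous_seminorm T p \<longleftrightarrow> seminorm_on (topspace T) p \<and> continuous_map T euclideanreal p"

text \<open>For \<open>p \<le> q\<close> every \<open>q\<close>-Cauchy sequence is \<open>p\<close>-Cauchy, and the canonical linking map between the
  local Banach spaces is induced by the identity.\<close>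

definition nuclear_space :: "'v::complex_vector topology \<Rightarrow> bool" where
  "nuclear_space T \<longleftrightarrow> locally_convex T \<and>
     (\<forall>p. continuous_seminorm T p \<longrightarrow>
       (\<exists>q. continuous_seminorm T q \<and> (\<forall>x\<in>topspace T. p x \<le> q x) \<and>
         nuclear_map_on (cauchy_seqs (topspace T) q) (completed_seminorm q)
           (cauchy_seqs (topspace T) p) (completed_seminorm p) (\<lambda>\<xi>. \<xi>)))"

section \<open>Duals of power series spaces\<close>

text \<open>Sequences indexed by \<open>{1, 2, 3, \<dots>}\<close> are shifted to \<^typ>\<open>nat\<close>: the value at \<open>i\<close> is the term of
  index \<open>i + 1\<close>. This applies to vectors, to weights, to \<open>\<alpha>\<close> and to \<open>s\<close>.\<close>

definition c0 :: "(nat \<Rightarrow> real) \<Rightarrow> (nat \<Rightarrow> complex) set" where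
  "c0 w = {x. (\<lambda>n. w n * cmod (x n)) \<longlonglongrightarrow> 0}"

text \<open>The junk value \<open>0\<close> outside \<open>c0 w\<close> is needed because the locale \<^locale>\<open>Metric_space\<close> requires the
  distance to be nonnegative everywhere, not only on the carrier.\<close>

definition c0_norm :: "(nat \<Rightarrow> real) \<Rightarrow> (nat \<Rightarrow> complex) \<Rightarrow> real" where
  "c0_norm w x = (if x \<in> c0 w then SUP n. w n * cmod (x n) else 0)"

definition c0_topology :: "(nat \<Rightarrow> real) \<Rightarrow> (nat \<Rightarrow> complex) topology" where
  "c0_topology w = Metric_space.mtopology (c0 w) (\<lambda>x y. c0_norm w (x - y))"

definition weight :: "(nat \<Rightarrow> real) \<Rightarrow> (nat \<Rightarrow> real) \<Rightarrow> nat \<Rightarrow> nat \<Rightarrow> real" where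
  "weight \<alpha> s k n = s k powr (- \<alpha> n)"

text \<open>The topology of coordinatewise convergence on the union of the steps is admissible, so
  \<open>ind_topology_finest\<close> applies.\<close>

definition E_space :: "(nat \<Rightarrow> real) \<Rightarrow> (nat \<Rightarrow> real) \<Rightarrow> (nat \<Rightarrow> complex) topology" where
  "E_space \<alpha> s = ind_topology (\<lambda>k. c0_topology (weight \<alpha> s k))"

definition cesaro :: "(nat \<Rightarrow> complex) \<Rightarrow> nat \<Rightarrow> complex" where
  "cesaro x n = (\<Sum>j\<le>n. x j) / of_nat (n + 1)"

end

theory Submission
  imports Defs
begin

text \<open>
  All three assertions are compared with the growth condition
  \<open>log_dominated\<close>, that is, \<open>ln (n + 1) \<le> K * \<alpha> n\<close> for some constant \<open>K\<close>. An element of the space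
  is a sequence bounded by some \<open>M * r powr \<alpha> n\<close>, so the condition says that multiplication by
  polynomials leaves the space invariant.

  \<^emph>\<open>Spectrum.\<close> Eigenvectors of the Cesaro operator grow polynomially: for the eigenvalue
  \<open>1 / (m + 1)\<close> the sequence \<open>n choose m\<close> is an eigenvector. Solving \<open>\<mu> x - C x = y\<close> for the
  partial sums of \<open>x\<close> gives a first order recursion whose factors are \<open>1 + O(1/n)\<close>, so the solution
  exceeds \<open>y\<close> only by a polynomial factor as soon as \<open>\<mu>\<close> is not the reciprocal of a positive integer. Under the growth
  condition the spectrum and the point spectrum are therefore both the set of these reciprocals. Conversely,
  \<open>1/2\<close> always lies in the spectrum, since the second unit sequence is not in the range of
  \<open>1/2 - C\<close>, and if it is an eigenvalue, then the sequence \<open>n\<close> lies in the space, which is the growth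
  condition. Likewise, if \<open>0\<close> lies in the resolvent set, then applying the inverse of \<open>C\<close> to
  the sequence \<open>(-1)^n\<close> produces a sequence of linear growth in the space.

  \<^emph>\<open>Nuclearity.\<close> Under the growth condition a continuous seminorm \<open>p\<close> is dominated by the weighted
  \<open>l1\<close>-norm with weights \<open>(n + 1)^2 * p (unit_seq n)\<close>, and the expansion in unit sequences is a nuclear
  representation with coefficients \<open>1 / (n + 1)^2\<close> (\<open>log_dominated_imp_nuclear\<close>). For the converse,
  the trace of the identity on the span of the first \<open>n + 1\<close> unit sequences is \<open>n + 1\<close>, while a nuclear
  representation bounds it by a constant times the largest ratio of the weights of two sup-norms
  (\<open>nuclear_map_trace_bound\<close>); for a suitable continuous seminorm that ratio is at most of
  order \<open>sqrt (n + 1)\<close> for infinitely many \<open>n\<close> if the growth condition fails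
  (\<open>nuclear_imp_log_dominated\<close>).

  The inductive limit topology enters only through two facts: a seminorm is continuous if and only if it is
  continuous on the steps (\<open>continuous_seminorm_ind_topology_iff\<close>), and a linear map is continuous if
  it is continuous on the steps (\<open>ind_topology_continuous_linear_map\<close>).
\<close>

section \<open>Seminorms and linear maps\<close>

lemma seminorm_on_zero:
  assumes "csubspace E" "seminorm_on E p" shows "p 0 = 0"
proof -
  have "p (0 *\<^sub>C 0) = cmod 0 * p 0"
    using assms complex_vector.subspace_0 unfolding seminorm_on_def by blast
  then show ?thesis by simp
qed

lemma seminorm_on_minus:
  assumes "csubspace E" "seminorm_on E p" "x \<in> E" "y \<in> E"
  shows "p (x - y) = p (y - x)"
proof -
  have "y - x \<in> E" using assms complex_vector.subspace_diff by blast
  then have "p ((-1) *\<^sub>C (y - x)) = cmod (-1) * p (y - x)"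
    using assms unfolding seminorm_on_def by blast
  moreover have "(-1) *\<^sub>C (y - x) = x - y"
    by (metis complex_vector.scale_minus_left complex_vector.scale_one minus_diff_eq)
  ultimately show ?thesis by simp
qed

lemma seminorm_on_triangle_diff:
  assumes "csubspace E" "seminorm_on E p" "x \<in> E" "y \<in> E" "z \<in> E"
  shows "p (x - z) \<le> p (x - y) + p (y - z)"
proof -
  have "x - y \<in> E" "y - z \<in> E" using assms complex_vector.subspace_diff by blast+
  then have "p ((x - y) + (y - z)) \<le> p (x - y) + p (y - z)"
    using assms unfolding seminorm_on_def by blast
  then show ?thesis by simp
qed

lemma seminorm_on_abs_diff:
  assumes "csubspace E" "seminorm_on E p" "x \<in> E" "y \<in> E"
  shows "\<bar>p x - p y\<bar> \<le> p (x - y)"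
  using seminorm_on_triangle_diff[OF assms(1,2), of x y 0] seminorm_on_triangle_diff[OF assms(1,2), of y x 0]
    seminorm_on_minus[OF assms(1-4)] complex_vector.subspace_0[OF assms(1)] assms(3,4)
  by simp

lemma seminorm_on_sum:
  assumes "csubspace E" "seminorm_on E p" "finite I" "\<And>i. i \<in> I \<Longrightarrow> f i \<in> E"
  shows "p (sum f I) \<le> (\<Sum>i\<in>I. p (f i))"
  using assms(3,4)
proof (induction I rule: finite_induct)
  case empty
  then show ?case using seminorm_on_zero[OF assms(1,2)] by simp
next
  case (insert i I)
  have "f i \<in> E" "sum f I \<in> E"
    using insert complex_vector.subspace_sum[OF assms(1), of I f] by auto
  then have "p (f i + sum f I) \<le> p (f i) + p (sum f I)"
    using assms(2) unfolding seminorm_on_def by blast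
  then show ?case using insert by simp
qed

lemma seminorm_on_subset: "seminorm_on E p \<Longrightarrow> F \<subseteq> E \<Longrightarrow> seminorm_on F p"
  unfolding seminorm_on_def by blast

lemma linear_map_on_zero:
  assumes "csubspace E" "linear_map_on E f" shows "f 0 = 0"
proof -
  have "f (0 *\<^sub>C 0) = 0 *\<^sub>C f 0"
    using assms complex_vector.subspace_0 unfolding linear_map_on_def by blast
  then show ?thesis by simp
qed

lemma linear_map_on_diff:
  assumes "csubspace E" "linear_map_on E f" "x \<in> E" "y \<in> E"
  shows "f (x - y) = f x - f y"
proof -
  have "x - y \<in> E" using assms complex_vector.subspace_diff by blast
  then have "f ((x - y) + y) = f (x - y) + f y"
    using assms unfolding linear_map_on_def by blast
  then show ?thesis by simp
qed

lemma linear_map_on_sum: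
  assumes "csubspace E" "linear_map_on E f" "finite I" "\<And>i. i \<in> I \<Longrightarrow> x i \<in> E"
  shows "f (\<Sum>i\<in>I. c i *\<^sub>C x i) = (\<Sum>i\<in>I. c i *\<^sub>C f (x i))"
  using assms(3,4)
proof (induction I rule: finite_induct)
  case empty
  then show ?case using linear_map_on_zero[OF assms(1,2)] by simp
next
  case (insert i I)
  have i: "x i \<in> E" and "c i *\<^sub>C x i \<in> E" "(\<Sum>i\<in>I. c i *\<^sub>C x i) \<in> E"
    using insert complex_vector.subspace_sum[OF assms(1), of I "\<lambda>i. c i *\<^sub>C x i"]
      complex_vector.subspace_scale[OF assms(1)] by auto
  then have "f (c i *\<^sub>C x i + (\<Sum>i\<in>I. c i *\<^sub>C x i)) = f (c i *\<^sub>C x i) + f (\<Sum>i\<in>I. c i *\<^sub>C x i)"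
    using assms(2) unfolding linear_map_on_def by blast
  also have "f (c i *\<^sub>C x i) = c i *\<^sub>C f (x i)"
    using i assms(2) unfolding linear_map_on_def by blast
  finally show ?case using insert by simp
qed

section \<open>The topology of a directed family of seminorms\<close>

text \<open>Only unit balls of single seminorms are used as neighbourhoods. This yields the locally convex topology
  generated by \<open>F\<close> when \<open>F\<close> is closed under sums and nonnegative multiples, as required of a
  \<open>seminorm_cone\<close>.\<close>

definition seminorm_topology :: "'v::complex_vector set \<Rightarrow> ('v \<Rightarrow> real) set \<Rightarrow> 'v topology" where
  "seminorm_topology E F =
     topology (\<lambda>U. U \<subseteq> E \<and> (\<forall>x\<in>U. \<exists>p\<in>F. \<forall>y\<in>E. p (y - x) < 1 \<longrightarrow> y \<in> U))"

locale seminorm_cone =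
  fixes E :: "'v::complex_vector set" and F :: "('v \<Rightarrow> real) set"
  assumes subspace: "csubspace E"
    and nonempty: "F \<noteq> {}"
    and seminorm: "\<And>p. p \<in> F \<Longrightarrow> seminorm_on E p"
    and add: "\<And>p q. p \<in> F \<Longrightarrow> q \<in> F \<Longrightarrow> (\<lambda>x. p x + q x) \<in> F"
    and scale: "\<And>p c. p \<in> F \<Longrightarrow> 0 \<le> c \<Longrightarrow> (\<lambda>x. c * p x) \<in> F"
begin

lemma scale_divide: "p \<in> F \<Longrightarrow> 0 < d \<Longrightarrow> (\<lambda>x. p x / d) \<in> F"
  using scale[of p "1 / d"] by simp

abbreviation "T \<equiv> seminorm_topology E F"

lemma diff_mem: "x \<in> E \<Longrightarrow> y \<in> E \<Longrightarrow> x - y \<in> E"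
  using complex_vector.subspace_diff[OF subspace] .

lemma nonneg: "p \<in> F \<Longrightarrow> x \<in> E \<Longrightarrow> 0 \<le> p x"
  using seminorm unfolding seminorm_on_def by blast

lemma openin_iff:
  "openin T U \<longleftrightarrow> U \<subseteq> E \<and> (\<forall>x\<in>U. \<exists>p\<in>F. \<forall>y\<in>E. p (y - x) < 1 \<longrightarrow> y \<in> U)"
proof -
  have "istopology (\<lambda>U. U \<subseteq> E \<and> (\<forall>x\<in>U. \<exists>p\<in>F. \<forall>y\<in>E. p (y - x) < 1 \<longrightarrow> y \<in> U))"
    unfolding istopology_def
  proof (intro conjI allI impI ballI)
    fix S T x
    assume S: "S \<subseteq> E \<and> (\<forall>x\<in>S. \<exists>p\<in>F. \<forall>y\<in>E. p (y - x) < 1 \<longrightarrow> y \<in> S)"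
      and T: "T \<subseteq> E \<and> (\<forall>x\<in>T. \<exists>p\<in>F. \<forall>y\<in>E. p (y - x) < 1 \<longrightarrow> y \<in> T)"
    show "S \<inter> T \<subseteq> E" using S by blast
    assume x: "x \<in> S \<inter> T"
    then obtain p q where p: "p \<in> F" "\<forall>y\<in>E. p (y - x) < 1 \<longrightarrow> y \<in> S"
      and q: "q \<in> F" "\<forall>y\<in>E. q (y - x) < 1 \<longrightarrow> y \<in> T" using S T by blast
    have "y \<in> S \<inter> T" if "y \<in> E" "p (y - x) + q (y - x) < 1" for y
    proof -
      have "y - x \<in> E" using that x S diff_mem by blast
      then have "0 \<le> p (y - x)" "0 \<le> q (y - x)" using nonneg p q by auto
      then show ?thesis using that p q by auto
    qed
    then show "\<exists>p\<in>F. \<forall>y\<in>E. p (y - x) < 1 \<longrightarrow> y \<in> S \<inter> T"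
      using add[OF p(1) q(1)] by (intro bexI[of _ "\<lambda>x. p x + q x"]) auto
  next
    fix \<K> x
    assume K: "\<forall>K\<in>\<K>. K \<subseteq> E \<and> (\<forall>x\<in>K. \<exists>p\<in>F. \<forall>y\<in>E. p (y - x) < 1 \<longrightarrow> y \<in> K)"
    show "\<Union>\<K> \<subseteq> E" using K by blast
    assume "x \<in> \<Union>\<K>"
    then show "\<exists>p\<in>F. \<forall>y\<in>E. p (y - x) < 1 \<longrightarrow> y \<in> \<Union>\<K>" using K by (meson UnionE UnionI)
  qed
  then show ?thesis unfolding seminorm_topology_def by simp
qed

lemma topspace: "topspace T = E"
proof -
  have "openin T E" using nonempty by (auto simp: openin_iff)
  then show ?thesis using openin_subset openin_topspace openin_iff by blast
qed

lemma ball_open: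
  assumes "p \<in> F" "x \<in> E"
  shows "openin T {y \<in> E. p (y - x) < r}"
  unfolding openin_iff
proof (intro conjI ballI)
  fix y assume y: "y \<in> {y \<in> E. p (y - x) < r}"
  define d where "d = r - p (y - x)"
  have d: "d > 0" using y by (simp add: d_def)
  show "\<exists>q\<in>F. \<forall>z\<in>E. q (z - y) < 1 \<longrightarrow> z \<in> {y \<in> E. p (y - x) < r}"
  proof (intro bexI[of _ "\<lambda>z. p z / d"] ballI impI)
    fix z assume z: "z \<in> E" "p (z - y) / d < 1"
    then have "p (z - y) < d" using d by (simp add: field_simps)
    moreover have "p (z - x) \<le> p (z - y) + p (y - x)"
      using seminorm_on_triangle_diff[OF subspace seminorm] assms y z by auto
    ultimately show "z \<in> {y \<in> E. p (y - x) < r}" using z by (simp add: d_def)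
  qed (use d assms scale_divide in auto)
qed auto

lemma continuous_seminorm_member:
  assumes "p \<in> F" shows "continuous_map T euclideanreal p"
  unfolding continuous_map_def
proof (intro conjI allI impI)
  fix U :: "real set" assume "openin euclidean U"
  then have U: "open U" by simp
  show "openin T {x \<in> topspace T. p x \<in> U}"
    unfolding openin_iff topspace
  proof (intro conjI ballI)
    fix x assume x: "x \<in> {x \<in> E. p x \<in> U}"
    then obtain e where e: "e > 0" "\<And>t. \<bar>t - p x\<bar> < e \<Longrightarrow> t \<in> U"
      using U unfolding open_dist dist_real_def by blast
    show "\<exists>q\<in>F. \<forall>y\<in>E. q (y - x) < 1 \<longrightarrow> y \<in> {x \<in> E. p x \<in> U}"
    proof (intro bexI[of _ "\<lambda>z. p z / e"] ballI impI)
      fix y assume y: "y \<in> E" "p (y - x) / e < 1"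
      then have "p (y - x) < e" using e by (simp add: field_simps)
      moreover have "\<bar>p y - p x\<bar> \<le> p (y - x)"
        using seminorm_on_abs_diff[OF subspace seminorm] assms x y by auto
      ultimately show "y \<in> {x \<in> E. p x \<in> U}" using e y by auto
    qed (use e assms scale_divide in auto)
  qed auto
qed auto

lemma locally_convex: "locally_convex T"
  unfolding locally_convex_def topspace
proof (intro conjI allI impI)
  show "csubspace E" by (fact subspace)
  show "continuous_map (prod_topology T T) T (\<lambda>(x, y). x + y)"
    unfolding continuous_map_def
  proof (intro conjI allI impI)
    show "(\<lambda>(x, y). x + y) \<in> topspace (prod_topology T T) \<rightarrow> topspace T"
      using complex_vector.subspace_add[OF subspace] by (auto simp: topspace)
    fix U assume U: "openin T U"
    show "openin (prod_topology T T) {x \<in> topspace (prod_topology T T). (case x of (x, y) \<Rightarrow> x + y) \<in> U}"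
      unfolding openin_prod_topology_alt
    proof (intro allI impI)
      fix x y
      assume "(x, y) \<in> {x \<in> topspace (prod_topology T T). (case x of (x, y) \<Rightarrow> x + y) \<in> U}"
      then have xy: "x \<in> E" "y \<in> E" "x + y \<in> U" by (auto simp: topspace)
      then obtain p where p: "p \<in> F" "\<forall>z\<in>E. p (z - (x + y)) < 1 \<longrightarrow> z \<in> U"
        using U unfolding openin_iff by blast
      have "x' + y' \<in> U" if "x' \<in> E" "y' \<in> E" "p (x' - x) < 1/2" "p (y' - y) < 1/2" for x' y'
      proof -
        have "p ((x' - x) + (y' - y)) \<le> p (x' - x) + p (y' - y)"
          using seminorm[OF p(1)] diff_mem that xy unfolding seminorm_on_def by blast
        moreover have "(x' - x) + (y' - y) = (x' + y') - (x + y)" by simp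
        ultimately have "p ((x' + y') - (x + y)) < 1" using that by simp
        then show ?thesis using p that complex_vector.subspace_add[OF subspace] by blast
      qed
      moreover have "p (x - x) < 1/2" "p (y - y) < 1/2"
        using seminorm_on_zero[OF subspace seminorm[OF p(1)]] by auto
      moreover have "openin T {z \<in> E. p (z - x) < 1/2}" "openin T {z \<in> E. p (z - y) < 1/2}"
        using ball_open p xy by blast+
      ultimately show "\<exists>V W. openin T V \<and> openin T W \<and> x \<in> V \<and> y \<in> W \<and>
         V \<times> W \<subseteq> {x \<in> topspace (prod_topology T T). (case x of (x, y) \<Rightarrow> x + y) \<in> U}"
        using xy
        by - (rule exI[of _ "{z \<in> E. p (z - x) < 1/2}"], rule exI[of _ "{z \<in> E. p (z - y) < 1/2}"],
          simp add: topspace subset_iff)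
    qed
  qed
  show "continuous_map (prod_topology euclidean T) T (\<lambda>(c, x). c *\<^sub>C x)"
    unfolding continuous_map_def
  proof (intro conjI allI impI)
    show "(\<lambda>(c, x). c *\<^sub>C x) \<in> topspace (prod_topology euclidean T) \<rightarrow> topspace T"
      using complex_vector.subspace_scale[OF subspace] by (auto simp: topspace)
    fix U assume U: "openin T U"
    show "openin (prod_topology euclidean T)
        {x \<in> topspace (prod_topology euclidean T). (case x of (c, x) \<Rightarrow> c *\<^sub>C x) \<in> U}"
      unfolding openin_prod_topology_alt
    proof (intro allI impI)
      fix c x
      assume "(c, x) \<in> {x \<in> topspace (prod_topology euclidean T). (case x of (c, x) \<Rightarrow> c *\<^sub>C x) \<in> U}"
      then have cx: "x \<in> E" "c *\<^sub>C x \<in> U" by (auto simp: topspace)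
      then obtain p where p: "p \<in> F" "\<forall>z\<in>E. p (z - c *\<^sub>C x) < 1 \<longrightarrow> z \<in> U"
        using U unfolding openin_iff by blast
      have px: "0 \<le> p x" using nonneg p cx by auto
      define d where "d = 1 / (2 * (p x + 1))"
      define e where "e = 1 / (2 * (cmod c + 1))"
      have d: "0 < d" "d \<le> 1" "d * p x \<le> 1/2" using px by (auto simp: d_def field_simps)
      have e: "0 < e" "(cmod c + 1) * e = 1/2"
        using norm_ge_zero[of c] by (auto simp: e_def field_simps add_pos_nonneg add_nonneg_eq_0_iff)
      have "c' *\<^sub>C x' \<in> U" if "x' \<in> E" "p (x' - x) < e" "cmod (c' - c) < d" for c' x'
      proof -
        have x'x: "x' - x \<in> E" using diff_mem that cx by blast
        have "cmod c' \<le> cmod c + cmod (c' - c)" by norm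
        then have c': "cmod c' \<le> cmod c + 1" using that d by linarith
        have "p (c' *\<^sub>C (x' - x) + (c' - c) *\<^sub>C x) \<le> p (c' *\<^sub>C (x' - x)) + p ((c' - c) *\<^sub>C x)"
          using seminorm[OF p(1)] x'x cx complex_vector.subspace_scale[OF subspace]
          unfolding seminorm_on_def by blast
        also have "\<dots> = cmod c' * p (x' - x) + cmod (c' - c) * p x"
          using seminorm[OF p(1)] x'x cx unfolding seminorm_on_def by metis
        also have "\<dots> \<le> (cmod c + 1) * p (x' - x) + d * p x"
          using c' that px nonneg[OF p(1) x'x] by (intro add_mono mult_right_mono) auto
        also have "(cmod c + 1) * p (x' - x) < (cmod c + 1) * e"
          using that norm_ge_zero[of c] by (intro mult_strict_left_mono) (auto simp: add_nonneg_pos)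
        also have "(cmod c + 1) * e + d * p x \<le> 1" using d e by linarith
        finally have "p (c' *\<^sub>C (x' - x) + (c' - c) *\<^sub>C x) < 1" by simp
        moreover have "c' *\<^sub>C (x' - x) + (c' - c) *\<^sub>C x = c' *\<^sub>C x' - c *\<^sub>C x"
          by (simp add: complex_vector.scale_right_diff_distrib complex_vector.scale_left_diff_distrib)
        ultimately show ?thesis using p that complex_vector.subspace_scale[OF subspace] by auto
      qed
      moreover have "p (x - x) < e" using seminorm_on_zero[OF subspace seminorm[OF p(1)]] e by auto
      ultimately show "\<exists>V W. openin euclidean V \<and> openin T W \<and> c \<in> V \<and> x \<in> W \<and>
         V \<times> W \<subseteq> {x \<in> topspace (prod_topology euclidean T). (case x of (c, x) \<Rightarrow> c *\<^sub>C x) \<in> U}"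
        using cx d
        by - (rule exI[of _ "ball c d"], rule exI[of _ "{z \<in> E. p (z - x) < e}"],
          simp add: ball_open p topspace subset_iff dist_norm norm_minus_commute)
    qed
  qed
  fix U assume "openin T U \<and> 0 \<in> U"
  then obtain p where p: "p \<in> F" "\<forall>y\<in>E. p (y - 0) < 1 \<longrightarrow> y \<in> U" unfolding openin_iff by blast
  have 0: "0 \<in> E" using complex_vector.subspace_0[OF subspace] .
  have "cconvex {y \<in> E. p (y - 0) < 1}"
    unfolding cconvex_def
  proof (intro ballI, goal_cases)
    case (1 x y t)
    have E: "complex_of_real t *\<^sub>C x \<in> E" "complex_of_real (1 - t) *\<^sub>C y \<in> E"
      using 1 complex_vector.subspace_scale[OF subspace] by auto
    have "p (complex_of_real t *\<^sub>C x + complex_of_real (1 - t) *\<^sub>C y)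
        \<le> p (complex_of_real t *\<^sub>C x) + p (complex_of_real (1 - t) *\<^sub>C y)"
      using seminorm[OF p(1)] E unfolding seminorm_on_def by blast
    also have "p (complex_of_real t *\<^sub>C x) = cmod t * p x"
      using 1 seminorm[OF p(1)] unfolding seminorm_on_def by blast
    also have "p (complex_of_real (1 - t) *\<^sub>C y) = cmod (complex_of_real (1 - t)) * p y"
      using 1 seminorm[OF p(1)] unfolding seminorm_on_def by blast
    also have "cmod t * p x + cmod (complex_of_real (1 - t)) * p y = t * p x + (1 - t) * p y"
      using 1 by (simp only: norm_of_real) simp
    also have "\<dots> < 1" using 1 by (intro convex_bound_lt) auto
    finally show ?case using E complex_vector.subspace_add[OF subspace] by auto
  qed
  then show "\<exists>V. openin T V \<and> 0 \<in> V \<and> V \<subseteq> U \<and> cconvex V"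
    using ball_open[OF p(1) 0] p 0 seminorm_on_zero[OF subspace seminorm[OF p(1)]]
    by (intro exI[of _ "{y \<in> E. p (y - 0) < 1}"]) auto
qed

lemma Hausdorff:
  assumes "\<And>x. x \<in> E \<Longrightarrow> x \<noteq> 0 \<Longrightarrow> \<exists>p\<in>F. p x \<noteq> 0"
  shows "Hausdorff_space T"
  unfolding Hausdorff_space_def topspace
proof (intro allI impI, goal_cases)
  case (1 x y)
  then have "x - y \<in> E" "x - y \<noteq> 0" using diff_mem by auto
  then obtain p where p: "p \<in> F" "p (x - y) \<noteq> 0" using assms by blast
  define r where "r = p (x - y) / 2"
  have r: "r > 0" using nonneg[OF p(1) \<open>x - y \<in> E\<close>] p by (simp add: r_def)
  have "\<not> (p (z - x) < r \<and> p (z - y) < r)" if "z \<in> E" for z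
    using seminorm_on_triangle_diff[OF subspace seminorm[OF p(1)], of x z y]
      seminorm_on_minus[OF subspace seminorm[OF p(1)], of x z] that 1 by (auto simp: r_def)
  then show ?case
    using 1 p r seminorm_on_zero[OF subspace seminorm[OF p(1)]]
    by - (rule exI[of _ "{z \<in> E. p (z - x) < r}"], rule exI[of _ "{z \<in> E. p (z - y) < r}"],
      auto intro!: ball_open simp: disjnt_iff)
qed

end

section \<open>Continuity on inductive limits\<close>

definition step_seminorms :: "('k \<Rightarrow> 'v::complex_vector topology) \<Rightarrow> ('v \<Rightarrow> real) set" where
  "step_seminorms G =
     {p. seminorm_on (\<Union>k. topspace (G k)) p \<and> (\<forall>k. continuous_map (G k) euclideanreal p)}"

lemma seminorm_cone_step_seminorms:
  assumes "csubspace (\<Union>k. topspace (G k))"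
  shows "seminorm_cone (\<Union>k. topspace (G k)) (step_seminorms G)"
proof
  show "step_seminorms G \<noteq> {}"
    unfolding step_seminorms_def
    by (auto intro!: exI[of _ "\<lambda>_. 0"] simp: seminorm_on_def)
next
  fix p q assume pq: "p \<in> step_seminorms G" "q \<in> step_seminorms G"
  then have "p (x + y) + q (x + y) \<le> (p x + q x) + (p y + q y)"
    if "x \<in> (\<Union>k. topspace (G k))" "y \<in> (\<Union>k. topspace (G k))" for x y
  proof -
    have "p (x + y) \<le> p x + p y" "q (x + y) \<le> q x + q y"
      using pq that unfolding step_seminorms_def seminorm_on_def by blast+
    then show ?thesis by simp
  qed
  then show "(\<lambda>x. p x + q x) \<in> step_seminorms G"
    using pq unfolding step_seminorms_def seminorm_on_def
    by (auto intro!: continuous_map_add simp: algebra_simps)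
next
  fix p and c :: real assume p: "p \<in> step_seminorms G" and c: "0 \<le> c"
  have "c * p (x + y) \<le> c * p x + c * p y"
    if "x \<in> (\<Union>k. topspace (G k))" "y \<in> (\<Union>k. topspace (G k))" for x y
  proof -
    have "p (x + y) \<le> p x + p y"
      using p that unfolding step_seminorms_def seminorm_on_def by blast
    then show ?thesis using c by (metis distrib_left mult_left_mono)
  qed
  then show "(\<lambda>x. c * p x) \<in> step_seminorms G"
    using p c unfolding step_seminorms_def seminorm_on_def
    by (auto intro!: continuous_map_real_mult simp: algebra_simps)
qed (use assms in \<open>auto simp: step_seminorms_def\<close>)

text \<open>A concrete admissible topology. Besides showing that the inductive limit topology has the properties
  it is named for, it is fine enough to make every stepwise continuous seminorm continuous.\<close>

lemma seminorm_topology_admissible: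
  assumes sub: "csubspace (\<Union>k. topspace (G k))"
    and translation: "\<And>k x. x \<in> topspace (G k) \<Longrightarrow> continuous_map (G k) (G k) (\<lambda>y. y - x)"
    and separating: "\<And>x. x \<in> (\<Union>k. topspace (G k)) \<Longrightarrow> x \<noteq> 0 \<Longrightarrow> \<exists>p\<in>step_seminorms G. p x \<noteq> 0"
  shows "ind_admissible G (seminorm_topology (\<Union>k. topspace (G k)) (step_seminorms G))"
proof -
  let ?E = "\<Union>k. topspace (G k)" and ?F = "step_seminorms G"
  interpret seminorm_cone ?E ?F using seminorm_cone_step_seminorms[OF sub] .
  have "continuous_map (G k) T (\<lambda>x. x)" for k
    unfolding continuous_map_def
  proof (intro conjI allI impI)
    show "(\<lambda>x. x) \<in> topspace (G k) \<rightarrow> topspace T" by (auto simp: topspace)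
    fix U assume U: "openin T U"
    show "openin (G k) {x \<in> topspace (G k). x \<in> U}"
    proof (subst openin_subopen, intro ballI)
      fix x assume x: "x \<in> {x \<in> topspace (G k). x \<in> U}"
      then obtain p where p: "p \<in> ?F" "\<forall>y\<in>?E. p (y - x) < 1 \<longrightarrow> y \<in> U"
        using U unfolding openin_iff by blast
      have "continuous_map (G k) euclideanreal (p \<circ> (\<lambda>y. y - x))"
        using translation[of x k] x p by (auto simp: step_seminorms_def intro: continuous_map_compose)
      then have "openin (G k) {y \<in> topspace (G k). (p \<circ> (\<lambda>y. y - x)) y \<in> {..<1}}"
        by (rule openin_continuous_map_preimage) auto
      then show "\<exists>T. openin (G k) T \<and> x \<in> T \<and> T \<subseteq> {x \<in> topspace (G k). x \<in> U}"
        using x p seminorm_on_zero[OF sub seminorm[OF p(1)]]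
        by (intro exI[of _ "{y \<in> topspace (G k). (p \<circ> (\<lambda>y. y - x)) y \<in> {..<1}}"]) auto
    qed
  qed
  then show ?thesis
    unfolding ind_admissible_def using topspace locally_convex Hausdorff[OF separating] by auto
qed

lemma continuous_map_ind_topology_of_admissible:
  assumes "ind_admissible G T" "continuous_map T Y f"
  shows "continuous_map (ind_topology G) Y f"
  using assms(2) ind_topology_openin[OF assms(1)] ind_topology_finest(1)[OF assms(1)] assms(1)
  unfolding continuous_map_def ind_admissible_def by metis

lemma continuous_seminorm_ind_topology_iff:
  assumes sub: "csubspace (\<Union>k. topspace (G k))"
    and adm: "ind_admissible G (seminorm_topology (\<Union>k. topspace (G k)) (step_seminorms G))"
  shows "continuous_seminorm (ind_topology G) p \<longleftrightarrow> p \<in> step_seminorms G"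
proof -
  interpret seminorm_cone "\<Union>k. topspace (G k)" "step_seminorms G"
    using seminorm_cone_step_seminorms[OF sub] .
  have ind: "topspace (ind_topology G) = (\<Union>k. topspace (G k))"
    "\<And>k. continuous_map (G k) (ind_topology G) (\<lambda>x. x)"
    using ind_topology_finest(1)[OF adm] by (auto simp: ind_admissible_def)
  show ?thesis
  proof
    assume "continuous_seminorm (ind_topology G) p"
    then show "p \<in> step_seminorms G"
      using continuous_map_compose[OF ind(2)]
      by (fastforce simp: continuous_seminorm_def step_seminorms_def ind(1) o_def)
  next
    assume "p \<in> step_seminorms G"
    then show "continuous_seminorm (ind_topology G) p"
      using continuous_map_ind_topology_of_admissible[OF adm continuous_seminorm_member]
      by (auto simp: continuous_seminorm_def ind(1) seminorm)
  qed
qed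

text \<open>The pullback of the product of two copies of the inductive limit topology along the graph map
  \<open>x \<mapsto> (x, R x)\<close> is again admissible: linearity of \<open>R\<close> makes it locally convex, and continuity on the
  steps makes the inclusions continuous. Hence it is coarser than the inductive limit topology, and
  \<open>R\<close> is continuous for it by construction.\<close>

lemma ind_topology_continuous_linear_map:
  assumes adm: "ind_admissible G T0"
    and lin: "linear_map_on (topspace (ind_topology G)) R"
    and steps: "\<And>k. continuous_map (G k) (ind_topology G) R"
  shows "continuous_map (ind_topology G) (ind_topology G) R"
proof -
  let ?T = "ind_topology G"
  let ?E = "topspace ?T"
  let ?f = "\<lambda>x. (x, R x)"
  let ?P = "pullback_topology ?E ?f (prod_topology ?T ?T)"
  have ind: "?E = (\<Union>k. topspace (G k))" "locally_convex ?T" "Hausdorff_space ?T"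
    "\<And>k. continuous_map (G k) ?T (\<lambda>x. x)"
    using ind_topology_finest(1)[OF adm] by (auto simp: ind_admissible_def)
  have sub: "csubspace ?E"
    and add: "continuous_map (prod_topology ?T ?T) ?T (\<lambda>(x, y). x + y)"
    and scale: "continuous_map (prod_topology euclidean ?T) ?T (\<lambda>(c, x). c *\<^sub>C x)"
    using ind(2) by (auto simp: locally_convex_def)
  have RE: "R x \<in> ?E" if "x \<in> ?E" for x
    using that steps unfolding ind(1) by (auto simp: continuous_map_def Pi_iff ind(1))
  have topP: "topspace ?P = ?E"
    using RE by (auto simp: topspace_pullback_topology)
  have "continuous_map ?P (prod_topology ?T ?T) (id \<circ> ?f)"
    by (intro continuous_map_pullback) simp
  then have idP: "continuous_map ?P ?T (\<lambda>x. x)" and RP: "continuous_map ?P ?T R"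
    by (simp_all add: continuous_map_paired)
  have into: "continuous_map X ?P g"
    if "continuous_map X ?T g" "continuous_map X ?T (R \<circ> g)" for X :: "'c topology" and g
  proof (rule continuous_map_pullback')
    show "continuous_map X (prod_topology ?T ?T) (?f \<circ> g)"
      using that by (simp add: o_def continuous_map_paired)
    show "topspace X \<subseteq> g -` ?E" using that(1) by (auto simp: continuous_map_def)
  qed
  have Radd: "R (x + y) = R x + R y" if "x \<in> ?E" "y \<in> ?E" for x y
    using lin that unfolding linear_map_on_def by blast
  have Rscale: "R (c *\<^sub>C x) = c *\<^sub>C R x" if "x \<in> ?E" for c x
    using lin that unfolding linear_map_on_def by blast
  have addP: "continuous_map (prod_topology ?P ?P) ?T (\<lambda>z. g (fst z) + g (snd z))"
    if g: "continuous_map ?P ?T g" for g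
  proof -
    have "continuous_map (prod_topology ?P ?P) (prod_topology ?T ?T) (\<lambda>z. (g (fst z), g (snd z)))"
      using continuous_map_compose[OF continuous_map_fst[of ?P ?P] g]
        continuous_map_compose[OF continuous_map_snd[of ?P ?P] g]
      by (simp add: continuous_map_paired o_def)
    from continuous_map_compose[OF this add] show ?thesis by (simp add: o_def)
  qed
  have scaleP: "continuous_map (prod_topology euclidean ?P) ?T (\<lambda>z. fst z *\<^sub>C g (snd z))"
    if g: "continuous_map ?P ?T g" for g
  proof -
    have "continuous_map (prod_topology (euclidean :: complex topology) ?P) (prod_topology euclidean ?T)
        (\<lambda>z. (fst z, g (snd z)))"
      using continuous_map_compose[OF continuous_map_snd[of euclidean ?P] g]
      by (simp add: continuous_map_paired o_def continuous_map_fst)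
    from continuous_map_compose[OF this scale] show ?thesis by (simp add: o_def)
  qed
  have "ind_admissible G ?P"
    unfolding ind_admissible_def locally_convex_def topP
  proof (intro conjI allI impI)
    show "csubspace ?E" by (fact sub)
    show "?E = (\<Union>k. topspace (G k))" by (fact ind(1))
    show "continuous_map (prod_topology ?P ?P) ?P (\<lambda>(x, y). x + y)"
      unfolding case_prod_unfold
    proof (rule into)
      show "continuous_map (prod_topology ?P ?P) ?T (R \<circ> (\<lambda>z. fst z + snd z))"
        by (rule continuous_map_eq[OF addP[OF RP]]) (auto simp: topP Radd)
    qed (rule addP[OF idP])
    show "continuous_map (prod_topology euclidean ?P) ?P (\<lambda>(c, x). c *\<^sub>C x)"
      unfolding case_prod_unfold
    proof (rule into)
      show "continuous_map (prod_topology euclidean ?P) ?T (R \<circ> (\<lambda>z. fst z *\<^sub>C snd z))"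
        by (rule continuous_map_eq[OF scaleP[OF RP]]) (auto simp: topP Rscale)
    qed (rule scaleP[OF idP])
    show "Hausdorff_space ?P"
      unfolding Hausdorff_space_def topP
    proof (intro allI impI, goal_cases)
      case (1 x y)
      then obtain U V where UV: "openin ?T U" "openin ?T V" "x \<in> U" "y \<in> V" "disjnt U V"
        using ind(3) unfolding Hausdorff_space_def by metis
      have "openin ?P {x \<in> ?E. x \<in> U}" "openin ?P {x \<in> ?E. x \<in> V}"
        using idP UV unfolding continuous_map_def topP by auto
      then show ?case using UV 1
        by - (rule exI[of _ "{x \<in> ?E. x \<in> U}"], rule exI[of _ "{x \<in> ?E. x \<in> V}"],
          auto simp: disjnt_iff)
    qed
    show "continuous_map (G k) ?P (\<lambda>x. x)" for k
      using ind(4) steps by (intro into) (simp_all add: o_def)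
    fix U assume U: "openin ?P U \<and> 0 \<in> U"
    then obtain W where W: "openin (prod_topology ?T ?T) W" "U = ?f -` W \<inter> ?E"
      by (auto simp: openin_pullback_topology)
    have "(0, 0) \<in> W" using U W linear_map_on_zero[OF sub lin] by auto
    then obtain A B where AB: "openin ?T A" "openin ?T B" "0 \<in> A" "0 \<in> B" "A \<times> B \<subseteq> W"
      using W(1) unfolding openin_prod_topology_alt by metis
    obtain A' where A': "openin ?T A'" "0 \<in> A'" "A' \<subseteq> A" "cconvex A'"
      using ind(2) AB unfolding locally_convex_def by metis
    obtain B' where B': "openin ?T B'" "0 \<in> B'" "B' \<subseteq> B" "cconvex B'"
      using ind(2) AB unfolding locally_convex_def by metis
    show "\<exists>V. openin ?P V \<and> 0 \<in> V \<and> V \<subseteq> U \<and> cconvex V"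
    proof (intro exI conjI)
      show "openin ?P (?f -` (A' \<times> B') \<inter> ?E)"
        using A'(1) B'(1) unfolding openin_pullback_topology
        by (intro exI[of _ "A' \<times> B'"]) (simp add: openin_prod_Times_iff)
      show "0 \<in> ?f -` (A' \<times> B') \<inter> ?E"
        using A' B' linear_map_on_zero[OF sub lin] complex_vector.subspace_0[OF sub] by auto
      show "?f -` (A' \<times> B') \<inter> ?E \<subseteq> U" using W(2) AB(5) A'(3) B'(3) by blast
      show "cconvex (?f -` (A' \<times> B') \<inter> ?E)"
        using A'(4) B'(4) complex_vector.subspace_add[OF sub] complex_vector.subspace_scale[OF sub]
        unfolding cconvex_def by (auto simp: Radd Rscale)
    qed
  qed
  from continuous_map_ind_topology_of_admissible[OF this RP] show ?thesis .
qed

section \<open>Weighted null sequences\<close>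

lemma scaleC_apply [simp]: "(c *\<^sub>C x) n = c * (x n :: complex)"
  by (simp add: scaleC_fun_def scaleC_complex_def)

lemma sum_fun_apply: "(\<Sum>i\<in>I. f i) n = (\<Sum>i\<in>I. f i n)"
  by (induction I rule: infinite_finite_induct) auto

definition unit_seq :: "nat \<Rightarrow> nat \<Rightarrow> complex" where
  "unit_seq n = (\<lambda>i. if i = n then 1 else 0)"

lemma unit_seq_combination:
  "finite I \<Longrightarrow> (\<Sum>i\<in>I. z i *\<^sub>C unit_seq i) = (\<lambda>i. if i \<in> I then z i else 0)"
  by (rule ext) (simp add: sum_fun_apply unit_seq_def if_distrib[of "(*) _"] cong: if_cong)

lemma c0_norm_upper: "x \<in> c0 w \<Longrightarrow> w n * cmod (x n) \<le> c0_norm w x"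
proof -
  assume x: "x \<in> c0 w"
  then have "Bseq (\<lambda>n. w n * cmod (x n))"
    unfolding c0_def using convergentI convergent_imp_Bseq by blast
  then have "bdd_above (range (\<lambda>n. w n * cmod (x n)))"
    by (simp add: Bseq_eq_bounded bounded_imp_bdd_above)
  then show ?thesis using x by (auto simp: c0_norm_def intro: cSUP_upper)
qed

lemma c0_norm_least: "x \<in> c0 w \<Longrightarrow> (\<And>n. w n * cmod (x n) \<le> M) \<Longrightarrow> c0_norm w x \<le> M"
  by (auto simp: c0_norm_def intro: cSUP_least)

locale positive_weight =
  fixes w :: "nat \<Rightarrow> real"
  assumes pos: "\<And>n. w n > 0"
begin

lemma csubspace_c0: "csubspace (c0 w)"
proof (rule complex_vector.subspaceI)
  show "0 \<in> c0 w" by (simp add: c0_def)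
next
  fix x y assume "x \<in> c0 w" "y \<in> c0 w"
  then have "(\<lambda>n. w n * cmod (x n) + w n * cmod (y n)) \<longlonglongrightarrow> 0 + 0"
    unfolding c0_def by (intro tendsto_add) auto
  then have lim: "(\<lambda>n. w n * cmod (x n) + w n * cmod (y n)) \<longlonglongrightarrow> 0" by simp
  have "w n * cmod ((x + y) n) \<le> w n * cmod (x n) + w n * cmod (y n)" for n
    using mult_left_mono[OF norm_triangle_ineq[of "x n" "y n"], of "w n"] pos[of n]
    by (simp add: distrib_left)
  moreover have "0 \<le> w n * cmod ((x + y) n)" for n using pos[of n] by simp
  ultimately show "x + y \<in> c0 w"
    unfolding c0_def mem_Collect_eq
    by (intro tendsto_sandwich[OF _ _ tendsto_const lim] always_eventually allI) auto
next
  fix c :: complex and x assume "x \<in> c0 w"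
  then have "(\<lambda>n. cmod c * (w n * cmod (x n))) \<longlonglongrightarrow> cmod c * 0"
    unfolding c0_def by (intro tendsto_mult) auto
  then show "c *\<^sub>C x \<in> c0 w" by (simp add: c0_def norm_mult mult_ac)
qed

lemma seminorm: "seminorm_on (c0 w) (c0_norm w)"
  unfolding seminorm_on_def
proof (intro conjI ballI allI)
  fix x assume x: "x \<in> c0 w"
  have "0 \<le> w 0 * cmod (x 0)" using pos[of 0] by simp
  then show "0 \<le> c0_norm w x" using c0_norm_upper[OF x, of 0] by linarith
next
  fix x y assume xy: "x \<in> c0 w" "y \<in> c0 w"
  show "c0_norm w (x + y) \<le> c0_norm w x + c0_norm w y"
  proof (rule c0_norm_least)
    show "x + y \<in> c0 w" using xy complex_vector.subspace_add[OF csubspace_c0] by blast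
    fix n
    have "w n * cmod ((x + y) n) \<le> w n * cmod (x n) + w n * cmod (y n)"
      using mult_left_mono[OF norm_triangle_ineq[of "x n" "y n"], of "w n"] pos[of n]
      by (simp add: distrib_left)
    then show "w n * cmod ((x + y) n) \<le> c0_norm w x + c0_norm w y"
      using c0_norm_upper[OF xy(1), of n] c0_norm_upper[OF xy(2), of n] by linarith
  qed
next
  have le: "c0_norm w (c *\<^sub>C x) \<le> cmod c * c0_norm w x" if x: "x \<in> c0 w" for c x
  proof (rule c0_norm_least)
    show "c *\<^sub>C x \<in> c0 w" using x complex_vector.subspace_scale[OF csubspace_c0] by blast
    fix n
    show "w n * cmod ((c *\<^sub>C x) n) \<le> cmod c * c0_norm w x"
      using mult_left_mono[OF c0_norm_upper[OF x, of n], of "cmod c"] by (simp add: norm_mult mult_ac)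
  qed
  fix c :: complex and x assume x: "x \<in> c0 w"
  show "c0_norm w (c *\<^sub>C x) = cmod c * c0_norm w x"
  proof (cases "c = 0")
    case True
    have "0 \<le> w 0 * cmod ((0 *\<^sub>C x) 0)" using pos[of 0] by simp
    moreover have "0 *\<^sub>C x \<in> c0 w" using x complex_vector.subspace_scale[OF csubspace_c0] by blast
    ultimately have "0 \<le> c0_norm w (0 *\<^sub>C x)" using c0_norm_upper[of "0 *\<^sub>C x" w 0] by linarith
    then show ?thesis using le[OF x, of 0] True by simp
  next
    case False
    have "c *\<^sub>C x \<in> c0 w" using x complex_vector.subspace_scale[OF csubspace_c0] by blast
    then have "c0_norm w (inverse c *\<^sub>C (c *\<^sub>C x)) \<le> cmod (inverse c) * c0_norm w (c *\<^sub>C x)"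
      by (rule le)
    moreover have "inverse c *\<^sub>C (c *\<^sub>C x) = x" using False by (simp add: complex_vector.scale_scale)
    ultimately have "cmod c * c0_norm w x \<le> cmod c * (cmod (inverse c) * c0_norm w (c *\<^sub>C x))"
      by (simp add: mult_left_mono)
    also have "\<dots> = cmod (c * inverse c) * c0_norm w (c *\<^sub>C x)" by (simp add: norm_mult)
    finally show ?thesis using le[OF x, of c] False by simp
  qed
qed

lemma eq_0_if_norm_0: "x \<in> c0 w \<Longrightarrow> c0_norm w x = 0 \<Longrightarrow> x = 0"
proof
  fix n assume "x \<in> c0 w" "c0_norm w x = 0"
  then have "w n * cmod (x n) \<le> 0" using c0_norm_upper by metis
  then show "x n = 0 n" using pos[of n] by (simp add: mult_le_0_iff)
qed

lemma unit_seq: "unit_seq n \<in> c0 w" "c0_norm w (unit_seq n) = w n"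
proof -
  show *: "unit_seq n \<in> c0 w"
    unfolding c0_def mem_Collect_eq unit_seq_def
    by (rule tendsto_eventually, rule eventually_sequentiallyI[of "Suc n"]) auto
  have "w i * cmod (unit_seq n i) \<le> w n" for i
    using pos[of n] by (simp add: unit_seq_def)
  then show "c0_norm w (unit_seq n) = w n"
    using c0_norm_least[OF *, of "w n"] c0_norm_upper[OF *, of n] by (simp add: unit_seq_def)
qed

text \<open>Only the tail of \<open>x\<close> remains, and its weighted entries tend to \<open>0\<close>. Through this density of the
  finitely supported sequences, continuous seminorms are controlled by their values on unit sequences.\<close>

lemma truncation_tendsto:
  assumes x: "x \<in> c0 w"
  shows "(\<lambda>N. c0_norm w (x - (\<Sum>n<N. x n *\<^sub>C unit_seq n))) \<longlonglongrightarrow> 0"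
proof (rule LIMSEQ_I)
  fix e :: real assume e: "e > 0"
  have "(\<lambda>n. w n * cmod (x n)) \<longlonglongrightarrow> 0" using x by (simp add: c0_def)
  from LIMSEQ_D[OF this, of "e / 2"] obtain M
    where "\<forall>n\<ge>M. norm (w n * cmod (x n) - 0) < e / 2" using e by auto
  then have M: "w n * cmod (x n) < e / 2" if "n \<ge> M" for n
    using that pos[of n] by (auto simp: abs_mult)
  have "c0_norm w (x - (\<Sum>n<N. x n *\<^sub>C unit_seq n)) \<le> e / 2"
    and "0 \<le> c0_norm w (x - (\<Sum>n<N. x n *\<^sub>C unit_seq n))" if "N \<ge> M" for N
  proof -
    have mem: "x - (\<Sum>n<N. x n *\<^sub>C unit_seq n) \<in> c0 w"
      using x unit_seq by (intro complex_vector.subspace_diff[OF csubspace_c0]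
          complex_vector.subspace_sum[OF csubspace_c0] complex_vector.subspace_scale[OF csubspace_c0]) auto
    then show "0 \<le> c0_norm w (x - (\<Sum>n<N. x n *\<^sub>C unit_seq n))"
      using seminorm unfolding seminorm_on_def by blast
    have "w n * cmod ((x - (\<Sum>n<N. x n *\<^sub>C unit_seq n)) n) \<le> e / 2" for n
      using M[of n] that e by (auto simp: unit_seq_combination)
    then show "c0_norm w (x - (\<Sum>n<N. x n *\<^sub>C unit_seq n)) \<le> e / 2"
      using c0_norm_least[OF mem] by blast
  qed
  then show "\<exists>M. \<forall>N\<ge>M. norm (c0_norm w (x - (\<Sum>n<N. x n *\<^sub>C unit_seq n)) - 0) < e"
    using e by (intro exI[of _ M]) force
qed

sublocale Metric_space "c0 w" "\<lambda>x y. c0_norm w (x - y)"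
proof
  have mem: "x - y \<in> c0 w" if "x \<in> c0 w" "y \<in> c0 w" for x y
    using complex_vector.subspace_diff[OF csubspace_c0 that] .
  show "0 \<le> c0_norm w (x - y)" for x y
  proof (cases "x - y \<in> c0 w")
    case True
    then show ?thesis using seminorm unfolding seminorm_on_def by blast
  qed (simp add: c0_norm_def)
  show "c0_norm w (x - y) = c0_norm w (y - x)" for x y
    by (simp add: c0_norm_def c0_def norm_minus_commute)
  show "c0_norm w (x - y) = 0 \<longleftrightarrow> x = y" if "x \<in> c0 w" "y \<in> c0 w" for x y
    using eq_0_if_norm_0[OF mem[OF that]] seminorm_on_zero[OF csubspace_c0 seminorm] by auto
  show "c0_norm w (x - z) \<le> c0_norm w (x - y) + c0_norm w (y - z)"
    if "x \<in> c0 w" "y \<in> c0 w" "z \<in> c0 w" for x y z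
    using seminorm_on_triangle_diff[OF csubspace_c0 seminorm that] .
qed

lemma topspace: "topspace (c0_topology w) = c0 w"
  by (simp add: c0_topology_def)

lemma openin_iff:
  "openin (c0_topology w) U \<longleftrightarrow>
     U \<subseteq> c0 w \<and> (\<forall>x\<in>U. \<exists>r>0. \<forall>y\<in>c0 w. c0_norm w (y - x) < r \<longrightarrow> y \<in> U)"
proof -
  have ball: "mball x r \<subseteq> U \<longleftrightarrow> (\<forall>y\<in>c0 w. c0_norm w (y - x) < r \<longrightarrow> y \<in> U)" if "x \<in> c0 w" for x r
    using that by (auto simp: mball_def commute[of x])
  show ?thesis
  proof (cases "U \<subseteq> c0 w")
    case True
    then have "(\<forall>x. x \<in> U \<longrightarrow> (\<exists>r>0. mball x r \<subseteq> U)) \<longleftrightarrow>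
        (\<forall>x\<in>U. \<exists>r>0. \<forall>y\<in>c0 w. c0_norm w (y - x) < r \<longrightarrow> y \<in> U)"
      using ball by (simp add: subset_iff Ball_def)
    then show ?thesis using True unfolding c0_topology_def openin_mtopology by simp
  qed (simp add: c0_topology_def openin_mtopology)
qed

lemma continuous_translation:
  assumes "x \<in> c0 w" shows "continuous_map (c0_topology w) (c0_topology w) (\<lambda>y. y - x)"
  unfolding continuous_map_def topspace
proof (intro conjI allI impI)
  show "(\<lambda>y. y - x) \<in> c0 w \<rightarrow> c0 w"
    using assms complex_vector.subspace_diff[OF csubspace_c0] by auto
  fix U assume "openin (c0_topology w) U"
  then have U: "\<exists>r>0. \<forall>z\<in>c0 w. c0_norm w (z - y) < r \<longrightarrow> z \<in> U" if "y \<in> U" for y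
    using that unfolding openin_iff by blast
  show "openin (c0_topology w) {y \<in> c0 w. y - x \<in> U}"
    unfolding openin_iff
  proof (intro conjI ballI)
    fix y assume "y \<in> {y \<in> c0 w. y - x \<in> U}"
    then obtain r where r: "r > 0" "\<forall>z\<in>c0 w. c0_norm w (z - (y - x)) < r \<longrightarrow> z \<in> U"
      using U by blast
    have "z - x \<in> U" if z: "z \<in> c0 w" "c0_norm w (z - y) < r" for z
    proof -
      have "(z - x) - (y - x) = z - y" by simp
      then show ?thesis
        using r(2) z complex_vector.subspace_diff[OF csubspace_c0 z(1) assms] by metis
    qed
    then show "\<exists>r>0. \<forall>z\<in>c0 w. c0_norm w (z - y) < r \<longrightarrow> z \<in> {y \<in> c0 w. y - x \<in> U}"
      using r(1) by blast
  qed auto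
qed

lemma continuous_seminorm_iff:
  assumes p: "seminorm_on (c0 w) p"
  shows "continuous_map (c0_topology w) euclideanreal p \<longleftrightarrow> (\<exists>C. \<forall>x\<in>c0 w. p x \<le> C * c0_norm w x)"
proof
  assume "continuous_map (c0_topology w) euclideanreal p"
  then have "openin (c0_topology w) {x \<in> topspace (c0_topology w). p x \<in> {..<1}}"
    by (rule openin_continuous_map_preimage) auto
  moreover have "0 \<in> {x \<in> topspace (c0_topology w). p x \<in> {..<1}}"
    using seminorm_on_zero[OF csubspace_c0 p] complex_vector.subspace_0[OF csubspace_c0] by (simp add: topspace)
  ultimately obtain r where r: "r > 0" "\<And>y. y \<in> c0 w \<Longrightarrow> c0_norm w y < r \<Longrightarrow> p y < 1"
    unfolding openin_iff topspace by force
  have "p x \<le> (2 / r) * c0_norm w x" if x: "x \<in> c0 w" for x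
  proof (cases "c0_norm w x = 0")
    case True
    then show ?thesis using eq_0_if_norm_0[OF x] seminorm_on_zero[OF csubspace_c0 p] by simp
  next
    case False
    then have n: "c0_norm w x > 0" using nonneg[of x 0] by simp
    define c where "c = r / (2 * c0_norm w x)"
    have c: "c > 0" using n r by (simp add: c_def)
    have cx: "complex_of_real c *\<^sub>C x \<in> c0 w"
      using x complex_vector.subspace_scale[OF csubspace_c0] by blast
    have "c0_norm w (complex_of_real c *\<^sub>C x) = cmod (complex_of_real c) * c0_norm w x"
      using seminorm x unfolding seminorm_on_def by blast
    also have "\<dots> = c * c0_norm w x" using c by simp
    also have "\<dots> < r" using n r by (simp add: c_def)
    finally have "p (complex_of_real c *\<^sub>C x) < 1" using r(2)[OF cx] by blast
    moreover have "p (complex_of_real c *\<^sub>C x) = cmod (complex_of_real c) * p x"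
      using p x unfolding seminorm_on_def by blast
    ultimately have "c * p x < 1" using c by simp
    then show ?thesis using n r by (simp add: c_def field_simps)
  qed
  then show "\<exists>C. \<forall>x\<in>c0 w. p x \<le> C * c0_norm w x" by blast
next
  assume "\<exists>C. \<forall>x\<in>c0 w. p x \<le> C * c0_norm w x"
  then obtain C where C: "\<And>x. x \<in> c0 w \<Longrightarrow> p x \<le> C * c0_norm w x" by blast
  show "continuous_map (c0_topology w) euclideanreal p"
    unfolding continuous_map_def
  proof (intro conjI allI impI)
    fix U :: "real set" assume "openin euclidean U"
    then have U: "open U" by simp
    show "openin (c0_topology w) {x \<in> topspace (c0_topology w). p x \<in> U}"
      unfolding openin_iff topspace
    proof (intro conjI ballI)
      fix x assume x: "x \<in> {x \<in> c0 w. p x \<in> U}"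
      then obtain e where e: "e > 0" "\<And>t. \<bar>t - p x\<bar> < e \<Longrightarrow> t \<in> U"
        using U unfolding open_dist dist_real_def by blast
      show "\<exists>r>0. \<forall>y\<in>c0 w. c0_norm w (y - x) < r \<longrightarrow> y \<in> {x \<in> c0 w. p x \<in> U}"
      proof (intro exI[of _ "e / (\<bar>C\<bar> + 1)"] conjI ballI impI)
        fix y assume y: "y \<in> c0 w" "c0_norm w (y - x) < e / (\<bar>C\<bar> + 1)"
        have "\<bar>p y - p x\<bar> \<le> p (y - x)"
          using seminorm_on_abs_diff[OF csubspace_c0 p] x y by auto
        also have "\<dots> \<le> C * c0_norm w (y - x)"
          using C x y complex_vector.subspace_diff[OF csubspace_c0] by auto
        also have "\<dots> \<le> (\<bar>C\<bar> + 1) * c0_norm w (y - x)" by (intro mult_right_mono) auto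
        also have "\<dots> < e" using y(2) by (simp add: field_simps)
        finally show "y \<in> {x \<in> c0 w. p x \<in> U}" using e y by auto
      qed (use e in auto)
    qed auto
  qed auto
qed

end

lemma continuous_map_c0_of_bounded:
  assumes "positive_weight v" "positive_weight w"
    and lin: "linear_map_on (c0 v) R"
    and bound: "\<And>x. x \<in> c0 v \<Longrightarrow> R x \<in> c0 w \<and> c0_norm w (R x) \<le> M * c0_norm v x"
  shows "continuous_map (c0_topology v) (c0_topology w) R"
proof -
  interpret v: positive_weight v by fact
  interpret w: positive_weight w by fact
  show ?thesis
    unfolding continuous_map_def v.topspace w.topspace
  proof (intro conjI allI impI)
    show "R \<in> c0 v \<rightarrow> c0 w" using bound by auto
    fix U assume U: "openin (c0_topology w) U"
    show "openin (c0_topology v) {x \<in> c0 v. R x \<in> U}"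
      unfolding v.openin_iff
    proof (intro conjI ballI)
      fix x assume x: "x \<in> {x \<in> c0 v. R x \<in> U}"
      then obtain e where e: "e > 0" "\<And>y. y \<in> c0 w \<Longrightarrow> c0_norm w (y - R x) < e \<Longrightarrow> y \<in> U"
        using U unfolding w.openin_iff by blast
      show "\<exists>r>0. \<forall>y\<in>c0 v. c0_norm v (y - x) < r \<longrightarrow> y \<in> {x \<in> c0 v. R x \<in> U}"
      proof (intro exI[of _ "e / (\<bar>M\<bar> + 1)"] conjI ballI impI)
        fix y assume y: "y \<in> c0 v" "c0_norm v (y - x) < e / (\<bar>M\<bar> + 1)"
        have "c0_norm w (R y - R x) = c0_norm w (R (y - x))"
          using linear_map_on_diff[OF v.csubspace_c0 lin] x y by simp
        also have "\<dots> \<le> M * c0_norm v (y - x)"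
          using bound x y complex_vector.subspace_diff[OF v.csubspace_c0] by auto
        also have "\<dots> \<le> (\<bar>M\<bar> + 1) * c0_norm v (y - x)" by (intro mult_right_mono) auto
        also have "\<dots> < e" using y(2) by (simp add: field_simps)
        finally show "y \<in> {x \<in> c0 v. R x \<in> U}" using e y bound by auto
      qed (use e in auto)
    qed auto
  qed
qed

lemma c0_mono:
  assumes "positive_weight v" "positive_weight w" and le: "\<And>n. w n \<le> D * v n" and x: "x \<in> c0 v"
  shows "x \<in> c0 w" "c0_norm w x \<le> D * c0_norm v x"
proof -
  interpret v: positive_weight v by fact
  interpret w: positive_weight w by fact
  have D: "D > 0" using le[of 0] v.pos[of 0] w.pos[of 0] by (smt (verit) mult_nonneg_nonneg zero_less_mult_pos2)
  have b: "w n * cmod (x n) \<le> D * (v n * cmod (x n))" for n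
    using mult_right_mono[OF le[of n], of "cmod (x n)"] by (simp add: mult_ac)
  have "(\<lambda>n. D * (v n * cmod (x n))) \<longlonglongrightarrow> D * 0"
    using x unfolding c0_def by (intro tendsto_mult) auto
  then have lim: "(\<lambda>n. D * (v n * cmod (x n))) \<longlonglongrightarrow> 0" by simp
  show "x \<in> c0 w"
    unfolding c0_def mem_Collect_eq using b w.pos
    by (intro tendsto_sandwich[OF _ _ tendsto_const lim] always_eventually allI) (auto simp: less_imp_le)
  then show "c0_norm w x \<le> D * c0_norm v x"
  proof (rule c0_norm_least)
    show "w n * cmod (x n) \<le> D * c0_norm v x" for n
      using b[of n] mult_left_mono[OF c0_norm_upper[OF x, of n], of D] D by linarith
  qed
qed

section \<open>The space \<open>E\<^sub>\<alpha>\<close>\<close>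

locale power_series_dual =
  fixes \<alpha> s :: "nat \<Rightarrow> real"
  assumes alpha_pos: "\<And>n. \<alpha> n > 0" and alpha_mono: "strict_mono \<alpha>"
    and alpha_lim: "filterlim \<alpha> at_top sequentially"
    and s_gt_1: "\<And>k. s k > 1" and s_mono: "strict_mono s"
    and s_lim: "filterlim s at_top sequentially"
begin

abbreviation v :: "nat \<Rightarrow> nat \<Rightarrow> real" where "v \<equiv> weight \<alpha> s"

definition E :: "(nat \<Rightarrow> complex) set" where "E = (\<Union>k. c0 (v k))"

text \<open>The condition \<open>sup (log n / \<alpha>\<^sub>n) < \<infinity>\<close> with indices shifted by one, so that the logarithm of the
  index \<open>n + 1\<close> occurs.\<close>

definition log_dominated :: bool where
  "log_dominated \<longleftrightarrow> (\<exists>K. \<forall>n. ln (real (n + 1)) \<le> K * \<alpha> n)"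

sublocale step: positive_weight "v k" for k
  using s_gt_1[of k] by unfold_locales (simp add: weight_def)

lemma alpha_le: "m \<le> n \<Longrightarrow> \<alpha> m \<le> \<alpha> n"
  using alpha_mono by (simp add: strict_mono_less_eq)

lemma exists_s_gt: "\<exists>k. s k > r"
  using s_lim by (metis filterlim_at_top_dense eventually_sequentially order_refl)

lemma weight_mult: "v k n * s k powr \<alpha> n = 1"
  using s_gt_1[of k] by (simp add: weight_def powr_minus)

lemma coordinate_bound:
  assumes "x \<in> c0 (v k)" shows "cmod (x n) \<le> c0_norm (v k) x * s k powr \<alpha> n"
proof -
  have "(v k n * cmod (x n)) * s k powr \<alpha> n \<le> c0_norm (v k) x * s k powr \<alpha> n"
    using c0_norm_upper[OF assms] by (intro mult_right_mono) auto
  moreover have "(v k n * cmod (x n)) * s k powr \<alpha> n = cmod (x n) * (v k n * s k powr \<alpha> n)"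
    by (simp only: mult_ac)
  ultimately show ?thesis by (simp add: weight_mult)
qed

text \<open>The strict inequality \<open>r < s j\<close> turns boundedness into convergence to \<open>0\<close>, because \<open>\<alpha>\<close> tends to
  infinity. Thus the space consists of the sequences with a bound of this kind, and passing to a later step
  absorbs any factor of the form \<open>r powr \<alpha> n\<close>.\<close>

lemma c0_step_of_growth:
  assumes r: "0 < r" "r < s j" and le: "\<And>n. cmod (x n) \<le> M * r powr \<alpha> n"
  shows "x \<in> c0 (v j)" "c0_norm (v j) x \<le> M"
proof -
  have "0 \<le> M * r powr \<alpha> 0" using le[of 0] norm_ge_zero[of "x 0"] by linarith
  then have M: "0 \<le> M" using r by (simp add: zero_le_mult_iff)
  define q where "q = r / s j"
  have q: "0 < q" "q < 1" using r s_gt_1[of j] by (auto simp: q_def)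
  have eq: "v j n * (M * r powr \<alpha> n) = M * q powr \<alpha> n" for n
    using r s_gt_1[of j] by (simp add: weight_def q_def powr_divide powr_minus field_simps)
  have b: "v j n * cmod (x n) \<le> M * q powr \<alpha> n" for n
    using mult_left_mono[OF le[of n], of "v j n"] step.pos[of j n] eq[of n] by simp
  have "filterlim (\<lambda>n. \<alpha> n * (- ln q)) at_top sequentially"
    using q by (intro filterlim_at_top_mult_tendsto_pos[OF tendsto_const _ alpha_lim]) simp
  then have "filterlim (\<lambda>n. - (\<alpha> n * (- ln q))) at_bot sequentially"
    by (simp add: filterlim_uminus_at_top)
  then have "(\<lambda>n. exp (- (\<alpha> n * (- ln q)))) \<longlonglongrightarrow> 0"
    by (rule filterlim_compose[OF exp_at_bot])
  then have "(\<lambda>n. q powr \<alpha> n) \<longlonglongrightarrow> 0" using q by (simp add: powr_def)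
  then have "(\<lambda>n. M * q powr \<alpha> n) \<longlonglongrightarrow> M * 0" by (intro tendsto_mult tendsto_const)
  then have lim: "(\<lambda>n. M * q powr \<alpha> n) \<longlonglongrightarrow> 0" by simp
  show mem: "x \<in> c0 (v j)"
    unfolding c0_def mem_Collect_eq using b step.pos[of j]
    by (intro tendsto_sandwich[OF _ _ tendsto_const lim] always_eventually allI) (auto simp: less_imp_le)
  show "c0_norm (v j) x \<le> M"
  proof (rule c0_norm_least[OF mem])
    fix n
    have "q powr \<alpha> n \<le> 1" using q alpha_pos[of n] by (simp add: powr_le1)
    then have "M * q powr \<alpha> n \<le> M" using M by (metis mult.right_neutral mult_left_mono)
    then show "v j n * cmod (x n) \<le> M" using b[of n] by linarith
  qed
qed

lemma step_mono: assumes "k \<le> j" shows "c0 (v k) \<subseteq> c0 (v j)"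
proof
  fix x assume x: "x \<in> c0 (v k)"
  show "x \<in> c0 (v j)"
  proof (cases "k = j")
    case False
    then have "s k < s j" using assms s_mono by (simp add: strict_mono_less)
    then show ?thesis using c0_step_of_growth(1)[OF _ _ coordinate_bound[OF x]] s_gt_1[of k] by simp
  qed (use x in simp)
qed

lemma in_E_of_growth: assumes "0 < r" "\<And>n. cmod (x n) \<le> M * r powr \<alpha> n" shows "x \<in> E"
  using exists_s_gt[of r] c0_step_of_growth(1)[OF assms(1) _ assms(2)] unfolding E_def by blast

lemma csubspace_E: "csubspace E"
proof (rule complex_vector.subspaceI)
  show "0 \<in> E" using complex_vector.subspace_0[OF step.csubspace_c0] unfolding E_def by blast
  show "x + y \<in> E" if xy: "x \<in> E" "y \<in> E" for x y
  proof -
    obtain k j where "x \<in> c0 (v k)" "y \<in> c0 (v j)" using xy unfolding E_def by blast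
    then have "x \<in> c0 (v (max k j))" "y \<in> c0 (v (max k j))"
      using step_mono by (meson max.cobounded1 max.cobounded2 subsetD)+
    then have "x + y \<in> c0 (v (max k j))" by (rule complex_vector.subspace_add[OF step.csubspace_c0])
    then show ?thesis unfolding E_def by blast
  qed
  show "c *\<^sub>C x \<in> E" if "x \<in> E" for c x
    using that complex_vector.subspace_scale[OF step.csubspace_c0] unfolding E_def by blast
qed

lemma unit_seq_in_E: "unit_seq n \<in> E"
  using step.unit_seq(1) unfolding E_def by blast

abbreviation steps :: "nat \<Rightarrow> (nat \<Rightarrow> complex) topology" where
  "steps \<equiv> \<lambda>k. c0_topology (v k)"

lemma Union_steps: "(\<Union>k. topspace (steps k)) = E"
  by (simp add: step.topspace E_def)

lemma step_seminorms_iff: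
  "p \<in> step_seminorms steps \<longleftrightarrow>
     seminorm_on E p \<and> (\<forall>k. \<exists>C. \<forall>x\<in>c0 (v k). p x \<le> C * c0_norm (v k) x)"
proof -
  have "seminorm_on (c0 (v k)) p" if "seminorm_on E p" for k
    using that by (rule seminorm_on_subset) (auto simp: E_def)
  then show ?thesis
    unfolding step_seminorms_def Union_steps using step.continuous_seminorm_iff by blast
qed

lemma steps_admissible: "ind_admissible steps (seminorm_topology E (step_seminorms steps))"
proof -
  have "\<exists>p\<in>step_seminorms steps. p x \<noteq> 0" if x: "x \<in> E" "x \<noteq> 0" for x
  proof -
    obtain n where n: "x n \<noteq> 0" using x by (metis ext zero_fun_apply)
    have "\<exists>C. \<forall>y\<in>c0 (v k). cmod (y n) \<le> C * c0_norm (v k) y" for k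
      using coordinate_bound[of _ k n] by (auto simp: mult.commute)
    moreover have "seminorm_on E (\<lambda>y. cmod (y n))"
      by (auto simp: seminorm_on_def norm_triangle_ineq norm_mult)
    ultimately have "(\<lambda>y. cmod (y n)) \<in> step_seminorms steps"
      by (simp add: step_seminorms_iff)
    then show ?thesis using n by (intro bexI[of _ "\<lambda>y. cmod (y n)"]) auto
  qed
  then show ?thesis
    by (intro seminorm_topology_admissible[of steps, unfolded Union_steps])
      (auto simp: csubspace_E step.topspace step.continuous_translation)
qed

lemma E_space_admissible: "ind_admissible steps (E_space \<alpha> s)"
  unfolding E_space_def using ind_topology_finest(1)[OF steps_admissible] .

lemma topspace_E_space: "topspace (E_space \<alpha> s) = E"
  using E_space_admissible by (simp add: ind_admissible_def Union_steps)

lemma continuous_seminorm_E_space_iff: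
  "continuous_seminorm (E_space \<alpha> s) p \<longleftrightarrow>
     seminorm_on E p \<and> (\<forall>k. \<exists>C. \<forall>x\<in>c0 (v k). p x \<le> C * c0_norm (v k) x)"
  unfolding E_space_def
  using continuous_seminorm_ind_topology_iff[of steps] steps_admissible csubspace_E
  by (simp add: Union_steps step_seminorms_iff)

lemma cont_lin_op_of_step_bounds:
  assumes lin: "linear_map_on E R"
    and bound: "\<And>k. \<exists>j M. \<forall>x\<in>c0 (v k). R x \<in> c0 (v j) \<and> c0_norm (v j) (R x) \<le> M * c0_norm (v k) x"
  shows "R \<in> cont_lin_ops (E_space \<alpha> s)"
proof -
  have "continuous_map (steps k) (E_space \<alpha> s) R" for k
  proof -
    obtain j M where "\<forall>x\<in>c0 (v k). R x \<in> c0 (v j) \<and> c0_norm (v j) (R x) \<le> M * c0_norm (v k) x"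
      using bound by blast
    moreover have "linear_map_on (c0 (v k)) R"
      using lin unfolding linear_map_on_def E_def by blast
    ultimately have "continuous_map (steps k) (steps j) R"
      by (intro continuous_map_c0_of_bounded step.positive_weight_axioms) auto
    moreover have "continuous_map (steps j) (E_space \<alpha> s) (\<lambda>x. x)"
      using E_space_admissible by (simp add: ind_admissible_def)
    ultimately have "continuous_map (steps k) (E_space \<alpha> s) ((\<lambda>x. x) \<circ> R)"
      by (rule continuous_map_compose)
    then show ?thesis by (simp add: o_def)
  qed
  then show ?thesis
    using ind_topology_continuous_linear_map[OF steps_admissible] lin topspace_E_space
    unfolding cont_lin_ops_def E_space_def by simp
qed

section \<open>Polynomial growth\<close>

lemma polynomial_dominated:
  assumes log_dominated shows "\<exists>r\<ge>1. \<forall>n. real (n + 1) ^ d \<le> r powr \<alpha> n"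
proof -
  obtain K where K: "\<And>n. ln (real (n + 1)) \<le> K * \<alpha> n" using assms unfolding log_dominated_def by blast
  have "real (n + 1) ^ d \<le> exp (real d * \<bar>K\<bar>) powr \<alpha> n" for n
  proof -
    have "K * \<alpha> n \<le> \<bar>K\<bar> * \<alpha> n" using alpha_pos[of n] by (intro mult_right_mono) auto
    then have "real d * ln (real (n + 1)) \<le> real d * (\<bar>K\<bar> * \<alpha> n)"
      using K[of n] by (intro mult_left_mono) auto
    then have "exp (real d * ln (real (n + 1))) \<le> exp (real d * (\<bar>K\<bar> * \<alpha> n))" by simp
    moreover have "exp (real d * ln (real (n + 1))) = real (n + 1) ^ d"
      by (simp add: exp_of_nat_mult)
    moreover have "exp (real d * (\<bar>K\<bar> * \<alpha> n)) = exp (real d * \<bar>K\<bar>) powr \<alpha> n"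
      by (simp add: powr_def mult_ac)
    ultimately show ?thesis by simp
  qed
  then show ?thesis by (intro exI[of _ "exp (real d * \<bar>K\<bar>)"]) auto
qed

lemma polynomial_multiple_step:
  assumes log_dominated
  shows "\<exists>j. \<forall>M x. (\<forall>n. cmod (x n) \<le> M * real (n + 1) ^ d * s k powr \<alpha> n) \<longrightarrow>
     x \<in> c0 (v j) \<and> c0_norm (v j) x \<le> M"
proof -
  obtain r where r: "r \<ge> 1" "\<And>n. real (n + 1) ^ d \<le> r powr \<alpha> n"
    using polynomial_dominated[OF assms] by blast
  obtain j where j: "r * s k < s j" using exists_s_gt by blast
  have "x \<in> c0 (v j) \<and> c0_norm (v j) x \<le> M"
    if x: "\<And>n. cmod (x n) \<le> M * real (n + 1) ^ d * s k powr \<alpha> n" for M x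
  proof -
    have "0 \<le> M * real (0 + 1) ^ d * s k powr \<alpha> 0" using x[of 0] norm_ge_zero order_trans by blast
    then have M: "0 \<le> M" using s_gt_1[of k] by (simp add: zero_le_mult_iff)
    have "cmod (x n) \<le> M * (r * s k) powr \<alpha> n" for n
    proof -
      have "M * real (n + 1) ^ d * s k powr \<alpha> n \<le> M * r powr \<alpha> n * s k powr \<alpha> n"
        using r M by (intro mult_right_mono mult_left_mono) auto
      then show ?thesis using x[of n] r s_gt_1[of k] by (simp add: powr_mult mult.assoc)
    qed
    then show ?thesis using c0_step_of_growth[OF _ j, of x M] r s_gt_1[of k] by simp
  qed
  then show ?thesis by blast
qed

text \<open>The source of every converse implication for the spectrum: a single element of linear growth forces
  the index \<open>n + 1\<close> itself to be bounded by \<open>M * s k powr \<alpha> n\<close>.\<close>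

lemma log_dominated_of_linear_growth:
  assumes x: "x \<in> E" and c: "c > 0" and le: "\<And>n. n \<ge> m \<Longrightarrow> c * real (n + 1) \<le> cmod (x n)"
  shows log_dominated
proof -
  obtain k where k: "x \<in> c0 (v k)" using x unfolding E_def by blast
  \<comment> \<open>the second entry takes care of the finitely many indices below \<open>m\<close>\<close>
  define M where "M = max (c0_norm (v k) x / c) (real m + 1)"
  have M: "M \<ge> 1" by (simp add: M_def)
  have W: "s k powr \<alpha> n \<ge> 1" for n
    using s_gt_1[of k] alpha_pos[of n] by (simp add: ge_one_powr_ge_zero)
  have b: "real (n + 1) \<le> M * s k powr \<alpha> n" for n
  proof (cases "n \<ge> m")
    case True
    have "c * real (n + 1) \<le> c0_norm (v k) x * s k powr \<alpha> n"
      using le[OF True] coordinate_bound[OF k, of n] by linarith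
    then have "real (n + 1) \<le> (c0_norm (v k) x / c) * s k powr \<alpha> n"
      using c by (simp add: field_simps)
    also have "\<dots> \<le> M * s k powr \<alpha> n" by (intro mult_right_mono) (auto simp: M_def)
    finally show ?thesis .
  next
    case False
    then have "real (n + 1) \<le> M * 1" by (auto simp: M_def)
    also have "\<dots> \<le> M * s k powr \<alpha> n" using W M by (intro mult_left_mono) auto
    finally show ?thesis .
  qed
  have "ln (real (n + 1)) \<le> (ln M / \<alpha> 0 + ln (s k)) * \<alpha> n" for n
  proof -
    have "ln (real (n + 1)) \<le> ln (M * s k powr \<alpha> n)" using b[of n] by simp
    also have "\<dots> = ln M + \<alpha> n * ln (s k)"
      using M s_gt_1[of k] by (simp add: ln_mult ln_powr)
    also have "ln M \<le> ln M / \<alpha> 0 * \<alpha> n"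
      using M alpha_le[of 0 n] alpha_pos[of 0] by (simp add: field_simps mult_left_mono)
    finally show ?thesis by (simp add: algebra_simps)
  qed
  then show ?thesis unfolding log_dominated_def by blast
qed

end

section \<open>The resolvent of the Cesaro operator\<close>

text \<open>If \<open>S\<close> denotes the partial sums of \<open>x\<close>, the equation \<open>\<mu> x - C x = y\<close> reads
  \<open>(\<mu> - 1 / (n + 1)) S\<^sub>n = \<mu> S\<^sub>n\<^sub>-\<^sub>1 + y\<^sub>n\<close> at the index \<open>n\<close>. Solving it for \<open>S\<close> rather than for \<open>x\<close>
  gives a recursion of order one.\<close>

primrec resolvent_sum :: "complex \<Rightarrow> (nat \<Rightarrow> complex) \<Rightarrow> nat \<Rightarrow> complex" where
  "resolvent_sum \<mu> y 0 = y 0 / (\<mu> - 1)"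
| "resolvent_sum \<mu> y (Suc n) =
     (\<mu> * resolvent_sum \<mu> y n + y (Suc n)) / (\<mu> - 1 / of_nat (n + 2))"

definition cesaro_resolvent :: "complex \<Rightarrow> (nat \<Rightarrow> complex) \<Rightarrow> nat \<Rightarrow> complex" where
  "cesaro_resolvent \<mu> y n =
     (case n of 0 \<Rightarrow> resolvent_sum \<mu> y 0 | Suc m \<Rightarrow> resolvent_sum \<mu> y (Suc m) - resolvent_sum \<mu> y m)"

lemma sum_cesaro_resolvent: "(\<Sum>j\<le>n. cesaro_resolvent \<mu> y j) = resolvent_sum \<mu> y n"
  by (induction n) (simp_all add: cesaro_resolvent_def)

lemma resolvent_sum_linear:
  "resolvent_sum \<mu> (x + y) n = resolvent_sum \<mu> x n + resolvent_sum \<mu> y n"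
  "resolvent_sum \<mu> (c *\<^sub>C x) n = c * resolvent_sum \<mu> x n"
  by (induction n) (simp_all add: add_divide_distrib algebra_simps)

lemma linear_cesaro_resolvent: "linear_map_on E (cesaro_resolvent \<mu>)"
  unfolding linear_map_on_def cesaro_resolvent_def fun_eq_iff
  by (auto simp: resolvent_sum_linear right_diff_distrib simp del: resolvent_sum.simps split: nat.split)

context
  fixes \<mu> :: complex
  assumes regular: "\<And>n. \<mu> \<noteq> 1 / of_nat (Suc n)"
begin

lemma cesaro_resolvent_right: "\<mu> *\<^sub>C cesaro_resolvent \<mu> y - cesaro (cesaro_resolvent \<mu> y) = y"
proof
  fix n
  show "(\<mu> *\<^sub>C cesaro_resolvent \<mu> y - cesaro (cesaro_resolvent \<mu> y)) n = y n"
  proof (cases n)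
    case 0
    have "\<mu> - 1 \<noteq> 0" using regular[of 0] by simp
    moreover have "\<mu> * y 0 - y 0 = (\<mu> - 1) * y 0" by (simp add: algebra_simps)
    ultimately show ?thesis using 0
      by (simp add: cesaro_def sum_cesaro_resolvent)
        (simp add: cesaro_resolvent_def diff_divide_distrib[symmetric])
  next
    case (Suc m)
    let ?d = "\<mu> - 1 / of_nat (m + 2)" and ?S = "resolvent_sum \<mu> y"
    have d: "?d \<noteq> 0" using regular[of "Suc m"] by simp
    have "(\<mu> *\<^sub>C cesaro_resolvent \<mu> y - cesaro (cesaro_resolvent \<mu> y)) n
        = \<mu> * (?S (Suc m) - ?S m) - ?S (Suc m) / of_nat (m + 2)"
      using Suc by (simp add: cesaro_def sum_cesaro_resolvent del: resolvent_sum.simps)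
        (simp add: cesaro_resolvent_def del: resolvent_sum.simps)
    also have "\<dots> = ?d * ?S (Suc m) - \<mu> * ?S m" by (simp add: algebra_simps del: resolvent_sum.simps)
    also have "?d * ?S (Suc m) = \<mu> * ?S m + y (Suc m)" using d by simp
    finally show ?thesis using Suc by simp
  qed
qed

lemma cesaro_resolvent_left: "cesaro_resolvent \<mu> (\<mu> *\<^sub>C x - cesaro x) = x"
proof -
  let ?y = "\<mu> *\<^sub>C x - cesaro x"
  have S: "resolvent_sum \<mu> ?y n = (\<Sum>j\<le>n. x j)" for n
  proof (induction n)
    case 0
    have "\<mu> - 1 \<noteq> 0" using regular[of 0] by simp
    then show ?case by (simp add: cesaro_def field_simps)
  next
    case (Suc n)
    let ?d = "\<mu> - 1 / of_nat (n + 2)"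
    have d: "?d \<noteq> 0" using regular[of "Suc n"] by simp
    have "\<mu> * (\<Sum>j\<le>n. x j) + ?y (Suc n) = ?d * (\<Sum>j\<le>Suc n. x j)"
      by (simp add: cesaro_def algebra_simps)
    then show ?case using d Suc by (simp add: nonzero_divide_eq_eq mult.commute)
  qed
  show ?thesis
  proof
    show "cesaro_resolvent \<mu> ?y n = x n" for n
      unfolding cesaro_resolvent_def by (cases n) (simp_all add: S del: resolvent_sum.simps)
  qed
qed

text \<open>For \<open>\<mu> \<noteq> 0\<close> the denominators stay away from \<open>0\<close>, so the first factor is \<open>1 + O(1/n)\<close> and the
  second one is even bounded. For \<open>\<mu> = 0\<close> the first factor vanishes, while the second one is \<open>n + 1\<close>;
  the linear term in the second bound is there for this case.\<close>

lemma resolvent_coefficients_bounded: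
  "\<exists>B\<ge>1. \<forall>n. cmod (\<mu> / (\<mu> - 1 / of_nat (n + 1))) \<le> 1 + B / real (n + 1) \<and>
     1 / cmod (\<mu> - 1 / of_nat (n + 1)) \<le> B * real (n + 1)"
proof (cases "\<mu> = 0")
  case True
  have "cmod (1 + of_nat n) \<le> 1 + real n" for n by (rule norm_triangle_le) simp
  then show ?thesis using True by (intro exI[of _ 1]) (simp add: norm_divide)
next
  case False
  have nz: "\<mu> - 1 / of_nat (n + 1) \<noteq> 0" for n using regular[of n] by simp
  have "(\<lambda>n. inverse (\<mu> - 1 / of_nat (n + 1))) \<longlonglongrightarrow> inverse (\<mu> - 0)"
    using False LIMSEQ_Suc[OF lim_1_over_n]
    by (intro tendsto_inverse tendsto_diff tendsto_const) auto
  then have "Bseq (\<lambda>n. inverse (\<mu> - 1 / of_nat (n + 1)))"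
    using convergentI convergent_imp_Bseq by blast
  then obtain B0 where "\<And>n. cmod (inverse (\<mu> - 1 / of_nat (n + 1))) \<le> B0" by (auto simp: Bseq_def)
  then have B0: "1 / cmod (\<mu> - 1 / of_nat (n + 1)) \<le> B0" for n by (simp add: norm_inverse divide_inverse)
  have frac: "(d + e) / d = 1 + e / d" if "d \<noteq> 0" for d e :: complex
    using that by (simp add: add_divide_distrib)
  define B where "B = max 1 B0"
  have B: "B \<ge> 1" "1 / cmod (\<mu> - 1 / of_nat (n + 1)) \<le> B" for n using B0[of n] by (auto simp: B_def)
  have 1: "cmod (\<mu> / (\<mu> - 1 / of_nat (n + 1))) \<le> 1 + B / real (n + 1)" for n
  proof -
    have "\<mu> / (\<mu> - 1 / of_nat (n + 1)) = 1 + (1 / of_nat (n + 1)) / (\<mu> - 1 / of_nat (n + 1))"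
      using frac[OF nz[of n], of "1 / of_nat (n + 1)"] by simp
    then have "cmod (\<mu> / (\<mu> - 1 / of_nat (n + 1)))
        \<le> cmod 1 + cmod ((1 / of_nat (n + 1)) / (\<mu> - 1 / of_nat (n + 1)))"
      by (metis norm_triangle_ineq)
    also have "\<dots> = 1 + 1 / cmod (\<mu> - 1 / of_nat (n + 1)) / real (n + 1)"
      by (simp only: norm_divide norm_of_nat norm_one) simp
    also have "\<dots> \<le> 1 + B / real (n + 1)" using B by (intro add_left_mono divide_right_mono) auto
    finally show ?thesis .
  qed
  have "1 / cmod (\<mu> - 1 / of_nat (n + 1)) \<le> B * real (n + 1)" for n
  proof -
    have "B * 1 \<le> B * real (n + 1)" using B(1) by (intro mult_left_mono) auto
    then show ?thesis using B(2)[of n] by linarith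
  qed
  then show ?thesis using 1 B(1) by blast
qed

text \<open>A product of \<open>n\<close> factors \<open>1 + B / k\<close> grows like \<open>n\<close> to the power \<open>B\<close>. The induction below shows
  it directly with an integer exponent, large enough to absorb the inhomogeneous term as well.\<close>

lemma resolvent_sum_growth:
  "\<exists>C\<ge>0. \<exists>d. \<forall>M W y. mono W \<and> (\<forall>n. 0 \<le> W n) \<and> (\<forall>n. cmod (y n) \<le> M * W n) \<longrightarrow>
     (\<forall>n. cmod (resolvent_sum \<mu> y n) \<le> C * M * W n * real (n + 1) ^ d)"
proof -
  obtain B where B: "B \<ge> 1"
    and B1: "\<And>n. cmod (\<mu> / (\<mu> - 1 / of_nat (n + 1))) \<le> 1 + B / real (n + 1)"
    and B2: "\<And>n. 1 / cmod (\<mu> - 1 / of_nat (n + 1)) \<le> B * real (n + 1)"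
    using resolvent_coefficients_bounded by blast
  \<comment> \<open>\<open>B\<close> units of the exponent pay for the factor \<open>1 + B / m\<close>, two more for the summand \<open>m + 1\<close>\<close>
  define d where "d = nat \<lceil>B\<rceil> + 2"
  have d: "B + 2 \<le> real (Suc d)" unfolding d_def by linarith
  have poly: "(1 + B / m) * m ^ Suc d + (m + 1) \<le> (m + 1) ^ Suc d" if m: "m \<ge> 1" for m :: real
  proof -
    have "1 + real (Suc d) * (1 / m) \<le> (1 + 1 / m) ^ Suc d"
      using m by (intro Bernoulli_inequality) (simp add: order_trans[OF _ divide_nonneg_nonneg])
    then have "m ^ Suc d * (1 + real (Suc d) * (1 / m)) \<le> m ^ Suc d * (1 + 1 / m) ^ Suc d"
      using m by (intro mult_left_mono) auto
    also have "m ^ Suc d * (1 + 1 / m) ^ Suc d = (m + 1) ^ Suc d"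
      using m by (simp only: power_mult_distrib[symmetric]) (simp add: distrib_left)
    also have "m ^ Suc d * (1 + real (Suc d) * (1 / m)) = m ^ Suc d + real (Suc d) * m ^ d"
      using m by (simp add: field_simps)
    finally have 1: "m ^ Suc d + real (Suc d) * m ^ d \<le> (m + 1) ^ Suc d" .
    have "m ^ 1 \<le> m ^ d" using m by (intro power_increasing) (auto simp: d_def)
    then have "m + 1 \<le> 2 * m ^ d" using m by simp
    moreover have "(B + 2) * m ^ d \<le> real (Suc d) * m ^ d" using m d by (intro mult_right_mono) auto
    moreover have "(1 + B / m) * m ^ Suc d = m ^ Suc d + B * m ^ d" using m by (simp add: field_simps)
    ultimately show ?thesis using 1 by (simp add: distrib_right)
  qed
  have "cmod (resolvent_sum \<mu> y n) \<le> B * M * W n * real (n + 1) ^ Suc d"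
    if W: "mono W" "\<And>n. 0 \<le> W n" and y: "\<And>n. cmod (y n) \<le> M * W n" for M W y n
  proof (induction n)
    case 0
    have "cmod (resolvent_sum \<mu> y 0) = 1 / cmod (\<mu> - 1 / of_nat (0 + 1)) * cmod (y 0)"
      by (simp add: norm_divide)
    also have "\<dots> \<le> B * (M * W 0)"
      using B2[of 0] y[of 0] B by (intro mult_mono) auto
    finally show ?case by simp
  next
    case (Suc n)
    define m where "m = real (n + 1)"
    have m: "m \<ge> 1" by (simp add: m_def)
    define K where "K = B * M * W (Suc n)"
    have MW: "0 \<le> M * W k" for k using y[of k] norm_ge_zero order_trans by blast
    \<comment> \<open>a negative \<open>M\<close> is possible only if \<open>W n = 0\<close>\<close>
    have MWm: "M * W n \<le> M * W (Suc n)"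
    proof (cases "M \<ge> 0")
      case True
      then show ?thesis using W(1) by (intro mult_left_mono) (auto simp: mono_def)
    next
      case False
      then have "W n = 0" using MW[of n] W(2)[of n] by (auto simp: zero_le_mult_iff)
      then show ?thesis using MW[of "Suc n"] by simp
    qed
    have K: "0 \<le> K" using B MW[of "Suc n"] by (simp add: K_def mult.assoc)
    let ?q = "\<mu> / (\<mu> - 1 / of_nat (Suc n + 1))"
    have q: "cmod ?q \<le> 1 + B / m"
    proof -
      have "B / real (Suc n + 1) \<le> B / m" using B by (intro divide_left_mono) (auto simp: m_def)
      then show ?thesis using B1[of "Suc n"] by linarith
    qed
    have S: "cmod (resolvent_sum \<mu> y n) \<le> K * m ^ Suc d"
    proof -
      have "B * (M * W n) * m ^ Suc d \<le> B * (M * W (Suc n)) * m ^ Suc d"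
        using B m by (intro mult_right_mono[OF mult_left_mono[OF MWm]]) auto
      then show ?thesis using Suc by (simp add: m_def K_def mult.assoc)
    qed
    have "resolvent_sum \<mu> y (Suc n)
        = ?q * resolvent_sum \<mu> y n + y (Suc n) / (\<mu> - 1 / of_nat (Suc n + 1))"
      by (simp add: add_divide_distrib)
    then have "cmod (resolvent_sum \<mu> y (Suc n))
        \<le> cmod ?q * cmod (resolvent_sum \<mu> y n) + 1 / cmod (\<mu> - 1 / of_nat (Suc n + 1)) * cmod (y (Suc n))"
      using norm_triangle_ineq[of "?q * resolvent_sum \<mu> y n" "y (Suc n) / (\<mu> - 1 / of_nat (Suc n + 1))"]
      by (simp add: norm_mult norm_divide)
    also have "\<dots> \<le> (1 + B / m) * (K * m ^ Suc d) + B * real (Suc n + 1) * (M * W (Suc n))"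
      using q S y[of "Suc n"] B2[of "Suc n"] B m by (intro add_mono mult_mono) auto
    also have "\<dots> = K * ((1 + B / m) * m ^ Suc d + (m + 1))"
      by (simp add: K_def m_def algebra_simps)
    also have "\<dots> \<le> K * (m + 1) ^ Suc d" using poly[OF m] K by (intro mult_left_mono) auto
    finally show ?case by (simp add: K_def m_def add_ac)
  qed
  then show ?thesis using B by (intro exI[of _ B] conjI exI[of _ "Suc d"]) auto
qed

end

section \<open>The spectrum of the Cesaro operator\<close>

context power_series_dual
begin

lemma log_dominated_imp_resolvent:
  assumes log_dominated and \<mu>: "\<And>n. \<mu> \<noteq> 1 / of_nat (Suc n)"
  shows "\<mu> \<in> resolvent_set (E_space \<alpha> s) cesaro"
proof -
  obtain C d where C: "C \<ge> 0"
    and S: "\<And>M W y n. mono W \<Longrightarrow> (\<And>n. 0 \<le> W n) \<Longrightarrow> (\<And>n. cmod (y n) \<le> M * W n) \<Longrightarrow>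
      cmod (resolvent_sum \<mu> y n) \<le> C * M * W n * real (n + 1) ^ d"
    using resolvent_sum_growth[OF \<mu>] by metis
  have "\<exists>j M. \<forall>y\<in>c0 (v k). cesaro_resolvent \<mu> y \<in> c0 (v j) \<and>
      c0_norm (v j) (cesaro_resolvent \<mu> y) \<le> M * c0_norm (v k) y" for k
  proof -
    obtain j where j: "\<And>M x. (\<And>n. cmod (x n) \<le> M * real (n + 1) ^ d * s k powr \<alpha> n) \<Longrightarrow>
        x \<in> c0 (v j) \<and> c0_norm (v j) x \<le> M"
      using polynomial_multiple_step[OF assms(1)] by meson
    have "cesaro_resolvent \<mu> y \<in> c0 (v j) \<and>
        c0_norm (v j) (cesaro_resolvent \<mu> y) \<le> 2 * C * c0_norm (v k) y" if y: "y \<in> c0 (v k)" for y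
    proof (rule j)
      fix n
      define P where "P n = C * c0_norm (v k) y * s k powr \<alpha> n * real (n + 1) ^ d" for n
      have b: "cmod (resolvent_sum \<mu> y n) \<le> P n" for n
        unfolding P_def using coordinate_bound[OF y] s_gt_1[of k] alpha_le
        by (intro S) (auto simp: mono_def intro!: powr_mono)
      have norm: "0 \<le> c0_norm (v k) y" using step.seminorm y unfolding seminorm_on_def by blast
      have P0: "P n \<ge> 0" using C norm by (simp add: P_def)
      have PS: "P m \<le> P (Suc m)" for m
        unfolding P_def using C norm s_gt_1[of k] alpha_le[of m "Suc m"]
        by (intro mult_mono mult_left_mono powr_mono power_mono) auto
      have "cmod (cesaro_resolvent \<mu> y n) \<le> 2 * P n"
      proof (cases n)
        case 0
        then show ?thesis using b[of 0] P0 by (simp add: cesaro_resolvent_def del: resolvent_sum.simps)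
      next
        case (Suc m)
        have "cmod (cesaro_resolvent \<mu> y (Suc m)) \<le> cmod (resolvent_sum \<mu> y (Suc m)) + cmod (resolvent_sum \<mu> y m)"
          by (simp add: cesaro_resolvent_def norm_triangle_ineq4 del: resolvent_sum.simps)
        then show ?thesis using b[of m] b[of "Suc m"] PS[of m] unfolding Suc by linarith
      qed
      then show "cmod (cesaro_resolvent \<mu> y n)
          \<le> 2 * C * c0_norm (v k) y * real (n + 1) ^ d * s k powr \<alpha> n"
        by (simp add: P_def mult_ac)
    qed
    then show ?thesis by blast
  qed
  then have "cesaro_resolvent \<mu> \<in> cont_lin_ops (E_space \<alpha> s)"
    by (rule cont_lin_op_of_step_bounds[OF linear_cesaro_resolvent])
  then show ?thesis
    unfolding resolvent_set_def
    using cesaro_resolvent_left[OF \<mu>] cesaro_resolvent_right[OF \<mu>] by blast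
qed

lemma point_spectrum_subset: "point_spectrum (E_space \<alpha> s) cesaro \<subseteq> spectrum (E_space \<alpha> s) cesaro"
proof
  fix \<mu> assume "\<mu> \<in> point_spectrum (E_space \<alpha> s) cesaro"
  moreover have "inj_on (\<lambda>x. \<mu> *\<^sub>C x - cesaro x) (topspace (E_space \<alpha> s))"
    if "\<mu> \<in> resolvent_set (E_space \<alpha> s) cesaro"
    using that unfolding resolvent_set_def by (auto intro: inj_on_inverseI)
  ultimately show "\<mu> \<in> spectrum (E_space \<alpha> s) cesaro"
    unfolding point_spectrum_def spectrum_def by blast
qed

text \<open>By the hockey-stick identity the partial sums of \<open>n choose m\<close> are \<open>(n + 1) choose (m + 1)\<close>, which is
  \<open>(n + 1) / (m + 1)\<close> times \<open>n choose m\<close>.\<close>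

lemma binomial_eigenvector:
  "(1 / of_nat (Suc m)) *\<^sub>C (\<lambda>n. of_nat (n choose m)) = cesaro (\<lambda>n. of_nat (n choose m))"
proof
  fix n
  have "(\<Sum>j\<le>n. of_nat (j choose m)) = (of_nat (Suc n choose Suc m) :: complex)"
    using sum_choose_upper[of m n] by (metis atLeast0AtMost of_nat_sum)
  moreover have "of_nat (Suc m) * of_nat (Suc n choose Suc m) = (of_nat (Suc n) * of_nat (n choose m) :: complex)"
    using Suc_times_binomial_eq[of n m] by (metis mult.commute of_nat_mult)
  ultimately show "((1 / of_nat (Suc m)) *\<^sub>C (\<lambda>n. of_nat (n choose m))) n
      = cesaro (\<lambda>n. of_nat (n choose m)) n"
    by (simp add: cesaro_def frac_eq_eq mult.commute del: of_nat_Suc binomial_Suc_Suc)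
qed

lemma log_dominated_imp_eigenvalue:
  assumes log_dominated
  shows "1 / of_nat (Suc m) \<in> point_spectrum (E_space \<alpha> s) cesaro"
proof -
  let ?x = "\<lambda>n. of_nat (n choose m) :: complex"
  obtain r where r: "r \<ge> 1" "\<And>n. real (n + 1) ^ m \<le> r powr \<alpha> n"
    using polynomial_dominated[OF assms] by blast
  have "cmod (?x n) \<le> 1 * r powr \<alpha> n" for n
  proof -
    have "n choose m \<le> (n + 1) ^ m"
    proof (cases "m \<le> n")
      case True
      then have "n choose m \<le> n ^ m" by (rule binomial_le_pow)
      also have "\<dots> \<le> (n + 1) ^ m" by (intro power_mono) auto
      finally show ?thesis .
    qed (simp add: binomial_eq_0)
    then have "real (n choose m) \<le> real (n + 1) ^ m" by (metis of_nat_le_iff of_nat_power)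
    then show ?thesis using r(2)[of n] by simp
  qed
  then have "?x \<in> E" using r by (intro in_E_of_growth[of r _ 1]) auto
  moreover have "0 \<in> E" using complex_vector.subspace_0[OF csubspace_E] .
  moreover have "?x \<noteq> 0" by (auto simp: fun_eq_iff intro!: exI[of _ m])
  moreover have "(1 / of_nat (Suc m)) *\<^sub>C ?x - cesaro ?x = (1 / of_nat (Suc m)) *\<^sub>C 0 - cesaro 0"
    unfolding binomial_eigenvector by (simp add: fun_eq_iff cesaro_def)
  ultimately show ?thesis
    unfolding point_spectrum_def inj_on_def topspace_E_space by blast
qed

text \<open>At the index \<open>1\<close> the diagonal entry of the triangular matrix \<open>1/2 - C\<close> vanishes, so a preimage of
  \<open>unit_seq 1\<close> would need a nonzero entry at the index \<open>0\<close>, which the equation at that index excludes.\<close>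

lemma half_in_spectrum: "1 / 2 \<in> spectrum (E_space \<alpha> s) cesaro"
proof -
  have "\<nexists>x. (1 / 2) *\<^sub>C x - cesaro x = unit_seq 1"
  proof
    assume "\<exists>x. (1 / 2) *\<^sub>C x - cesaro x = unit_seq 1"
    then obtain x where x: "(1 / 2) *\<^sub>C x - cesaro x = unit_seq 1" by blast
    have "x 0 = 0" using fun_cong[OF x, of 0] by (simp add: cesaro_def unit_seq_def)
    then show False using fun_cong[OF x, of 1] by (simp add: cesaro_def unit_seq_def)
  qed
  then show ?thesis
    using unit_seq_in_E[of 1] topspace_E_space unfolding spectrum_def resolvent_set_def by blast
qed

text \<open>Differences of consecutive instances of the eigenvalue equation give \<open>n u\<^sub>n\<^sub>+\<^sub>1 = (n + 1) u\<^sub>n\<close>, so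
  every eigenvector is a multiple of the sequence \<open>n\<close>.\<close>

lemma log_dominated_if_half_eigenvalue:
  assumes "1 / 2 \<in> point_spectrum (E_space \<alpha> s) cesaro" shows log_dominated
proof -
  obtain x y where xy: "x \<in> E" "y \<in> E" "x \<noteq> y" "(1 / 2) *\<^sub>C x - cesaro x = (1 / 2) *\<^sub>C y - cesaro y"
    using assms unfolding point_spectrum_def inj_on_def topspace_E_space by blast
  define u where "u = x - y"
  have uE: "u \<in> E" using xy complex_vector.subspace_diff[OF csubspace_E] by (simp add: u_def)
  have u: "u n / 2 = (\<Sum>j\<le>n. u j) / of_nat (n + 1)" for n
    using fun_cong[OF xy(4), of n]
    by (simp add: u_def cesaro_def sum_subtractf diff_divide_distrib del: of_nat_add of_nat_Suc)
      (metis (no_types) add_diff_cancel_left' diff_add_cancel diff_diff_eq2 add.commute diff_eq_eq)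
  have S: "2 * (\<Sum>j\<le>n. u j) = of_nat (n + 1) * u n" for n
    using u[of n] by (simp add: field_simps del: of_nat_Suc)
  have u0: "u 0 = 0" using S[of 0] by simp
  have un: "u n = of_nat n * u 1" for n
  proof (induction n)
    case (Suc n)
    show ?case
    proof (cases "n = 0")
      case False
      have "of_nat (n + 2) * u (Suc n) = of_nat (n + 1) * u n + 2 * u (Suc n)"
        using S[of n] S[of "Suc n"] by (simp add: algebra_simps)
      then have "of_nat n * u (Suc n) = of_nat (n + 1) * u n" by (simp add: algebra_simps)
      then have "of_nat n * u (Suc n) = of_nat n * (of_nat (Suc n) * u 1)"
        using Suc by (simp add: algebra_simps)
      then show ?thesis using False by (metis mult_left_cancel of_nat_eq_0_iff)
    qed simp
  qed (simp add: u0)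
  have "u \<noteq> 0" using xy by (simp add: u_def)
  then have u1: "u 1 \<noteq> 0" using un by (metis ext mult_zero_right zero_fun_apply)
  show ?thesis
  proof (rule log_dominated_of_linear_growth[OF uE, of "cmod (u 1) / 2" 1])
    fix n :: nat assume "n \<ge> 1"
    then have "cmod (u 1) * real (n + 1) \<le> cmod (u 1) * (2 * real n)" by (intro mult_left_mono) auto
    then show "cmod (u 1) / 2 * real (n + 1) \<le> cmod (u n)" by (subst un[of n]) (simp add: norm_mult mult_ac)
  qed (use u1 in simp)
qed

text \<open>Since \<open>C x = y\<close> forces \<open>x\<^sub>n = (n + 1) y\<^sub>n - n y\<^sub>n\<^sub>-\<^sub>1\<close>, an alternating \<open>y\<close> prevents cancellation.\<close>

lemma log_dominated_if_zero_resolvent: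
  assumes "0 \<in> resolvent_set (E_space \<alpha> s) cesaro" shows log_dominated
proof -
  define y :: "nat \<Rightarrow> complex" where "y n = (-1) ^ n" for n
  have "y \<in> E" by (rule in_E_of_growth[of 1 _ 1]) (auto simp: y_def norm_power)
  moreover obtain R where R: "R \<in> cont_lin_ops (E_space \<alpha> s)"
    "\<And>x. x \<in> E \<Longrightarrow> 0 *\<^sub>C R x - cesaro (R x) = x"
    using assms unfolding resolvent_set_def topspace_E_space by blast
  ultimately have "0 *\<^sub>C R y - cesaro (R y) = y" and "R y \<in> E"
    by (auto simp: cont_lin_ops_def continuous_map_def topspace_E_space Pi_iff)
  then have "R y \<in> E" "cesaro (R y) = - y" by (auto simp: minus_equation_iff)
  then have S: "(\<Sum>j\<le>n. R y j) = - (of_nat (n + 1) * y n)" for n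
  proof -
    have "(\<Sum>j\<le>n. R y j) / of_nat (n + 1) = - y n"
      using fun_cong[OF \<open>cesaro (R y) = - y\<close>, of n] by (simp add: cesaro_def)
    moreover have "of_nat (n + 1) \<noteq> (0 :: complex)" by (metis Suc_eq_plus1 of_nat_neq_0)
    ultimately have "(\<Sum>j\<le>n. R y j) = - y n * of_nat (n + 1)" by (metis nonzero_divide_eq_eq)
    then show ?thesis by (simp add: mult.commute)
  qed
  show ?thesis
  proof (rule log_dominated_of_linear_growth[OF \<open>R y \<in> E\<close>, of 1 1])
    fix n :: nat assume "n \<ge> 1"
    then obtain m where m: "n = Suc m" by (cases n) auto
    have "R y n = (\<Sum>j\<le>Suc m. R y j) - (\<Sum>j\<le>m. R y j)" by (simp add: m)
    also have "\<dots> = of_nat (2 * m + 3) * y m" unfolding S by (simp add: y_def algebra_simps)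
    finally have "cmod (R y n) = real (2 * m + 3)"
      by (simp only: norm_mult norm_of_nat) (simp add: y_def norm_power)
    then show "1 * real (n + 1) \<le> cmod (R y n)" by (simp add: m)
  qed simp
qed

lemma log_dominated_imp_spectrum:
  assumes log_dominated
  shows "spectrum (E_space \<alpha> s) cesaro = {1 / of_nat n | n :: nat. n \<ge> 1}"
    and "point_spectrum (E_space \<alpha> s) cesaro = {1 / of_nat n | n :: nat. n \<ge> 1}"
proof -
  let ?I = "{1 / of_nat n | n :: nat. n \<ge> 1} :: complex set"
  have "\<mu> \<in> ?I" if "\<mu> \<in> spectrum (E_space \<alpha> s) cesaro" for \<mu>
  proof (rule ccontr)
    assume "\<mu> \<notin> ?I"
    then have "\<mu> \<noteq> 1 / of_nat (Suc n)" for n by (auto simp del: of_nat_Suc)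
    then show False
      using log_dominated_imp_resolvent[OF assms] that unfolding spectrum_def by blast
  qed
  moreover have "\<mu> \<in> point_spectrum (E_space \<alpha> s) cesaro" if \<mu>: "\<mu> \<in> ?I" for \<mu>
  proof -
    obtain n :: nat where n: "\<mu> = 1 / of_nat n" "n \<ge> 1" using \<mu> by blast
    then show ?thesis using log_dominated_imp_eigenvalue[OF assms, of "n - 1"] by simp
  qed
  ultimately show "spectrum (E_space \<alpha> s) cesaro = ?I" "point_spectrum (E_space \<alpha> s) cesaro = ?I"
    using point_spectrum_subset by blast+
qed

lemma spectrum_eq_point_spectrum_iff:
  "spectrum (E_space \<alpha> s) cesaro = point_spectrum (E_space \<alpha> s) cesaro \<longleftrightarrow> log_dominated"
  using log_dominated_imp_spectrum half_in_spectrum log_dominated_if_half_eigenvalue by blast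

lemma spectrum_eq_reciprocals_iff:
  "spectrum (E_space \<alpha> s) cesaro = {1 / of_nat n | n :: nat. n \<ge> 1} \<longleftrightarrow> log_dominated"
proof
  assume *: "spectrum (E_space \<alpha> s) cesaro = {1 / of_nat n | n :: nat. n \<ge> 1}"
  have "0 \<notin> ({1 / of_nat n | n :: nat. n \<ge> 1} :: complex set)" by auto
  then show log_dominated
    using log_dominated_if_zero_resolvent unfolding *[symmetric] spectrum_def by blast
qed (use log_dominated_imp_spectrum in blast)

end

section \<open>Nuclear maps between completions\<close>

lemma cauchy_seqs_tail:
  assumes "\<xi> \<in> cauchy_seqs E p" "e > 0"
  obtains M where "\<And>m n. m \<ge> M \<Longrightarrow> n \<ge> M \<Longrightarrow> p (\<xi> m - \<xi> n) < e"
  using assms unfolding cauchy_seqs_def by blast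

lemma cauchy_seqs_mono:
  assumes "csubspace E" "\<And>x. x \<in> E \<Longrightarrow> p x \<le> q x" "\<xi> \<in> cauchy_seqs E q"
  shows "\<xi> \<in> cauchy_seqs E p"
proof -
  have "p (\<xi> m - \<xi> n) \<le> q (\<xi> m - \<xi> n)" for m n
    using assms complex_vector.subspace_diff[OF assms(1)] unfolding cauchy_seqs_def by blast
  then show ?thesis using assms(3) unfolding cauchy_seqs_def by (auto, meson order_le_less_trans)
qed

lemma const_in_cauchy_seqs:
  assumes "csubspace E" "seminorm_on E p" "x \<in> E" shows "(\<lambda>_. x) \<in> cauchy_seqs E p"
  using assms seminorm_on_zero[OF assms(1,2)] by (auto simp: cauchy_seqs_def)

lemma csubspace_cauchy_seqs:
  assumes sub: "csubspace E" and p: "seminorm_on E p" shows "csubspace (cauchy_seqs E p)"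
proof (rule complex_vector.subspaceI)
  show "0 \<in> cauchy_seqs E p"
    using const_in_cauchy_seqs[OF sub p complex_vector.subspace_0[OF sub]] by (simp add: zero_fun_def)
next
  fix \<xi> \<eta> assume X: "\<xi> \<in> cauchy_seqs E p" "\<eta> \<in> cauchy_seqs E p"
  then have mem: "\<xi> m \<in> E" "\<eta> m \<in> E" for m unfolding cauchy_seqs_def by blast+
  have "\<exists>M. \<forall>m\<ge>M. \<forall>n\<ge>M. p ((\<xi> + \<eta>) m - (\<xi> + \<eta>) n) < e" if e: "e > 0" for e
  proof -
    obtain M where M: "\<And>m n. m \<ge> M \<Longrightarrow> n \<ge> M \<Longrightarrow> p (\<xi> m - \<xi> n) < e / 2"
      using cauchy_seqs_tail[OF X(1), of "e / 2"] e by auto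
    obtain M' where M': "\<And>m n. m \<ge> M' \<Longrightarrow> n \<ge> M' \<Longrightarrow> p (\<eta> m - \<eta> n) < e / 2"
      using cauchy_seqs_tail[OF X(2), of "e / 2"] e by auto
    have "p ((\<xi> + \<eta>) m - (\<xi> + \<eta>) n) < e" if "m \<ge> max M M'" "n \<ge> max M M'" for m n
    proof -
      have "p ((\<xi> m - \<xi> n) + (\<eta> m - \<eta> n)) \<le> p (\<xi> m - \<xi> n) + p (\<eta> m - \<eta> n)"
        using p complex_vector.subspace_diff[OF sub] mem unfolding seminorm_on_def by blast
      also have "\<dots> < e" using M[of m n] M'[of m n] that by simp
      finally show ?thesis by (simp add: algebra_simps)
    qed
    then show ?thesis by blast
  qed
  then show "\<xi> + \<eta> \<in> cauchy_seqs E p"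
    unfolding cauchy_seqs_def using mem complex_vector.subspace_add[OF sub] by simp
next
  fix c \<xi> assume X: "\<xi> \<in> cauchy_seqs E p"
  then have mem: "\<xi> m \<in> E" for m unfolding cauchy_seqs_def by blast
  have "\<exists>M. \<forall>m\<ge>M. \<forall>n\<ge>M. p ((c *\<^sub>C \<xi>) m - (c *\<^sub>C \<xi>) n) < e" if e: "e > 0" for e
  proof -
    have c: "0 < cmod c + 1" using norm_ge_zero[of c] by linarith
    obtain M where M: "\<And>m n. m \<ge> M \<Longrightarrow> n \<ge> M \<Longrightarrow> p (\<xi> m - \<xi> n) < e / (cmod c + 1)"
      using cauchy_seqs_tail[OF X, of "e / (cmod c + 1)"] e c by auto
    have "p ((c *\<^sub>C \<xi>) m - (c *\<^sub>C \<xi>) n) < e" if "m \<ge> M" "n \<ge> M" for m n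
    proof -
      have d: "\<xi> m - \<xi> n \<in> E" by (rule complex_vector.subspace_diff[OF sub mem mem])
      have "(c *\<^sub>C \<xi>) m - (c *\<^sub>C \<xi>) n = c *\<^sub>C (\<xi> m - \<xi> n)"
        by (simp add: scaleC_fun_def complex_vector.scale_right_diff_distrib)
      then have "p ((c *\<^sub>C \<xi>) m - (c *\<^sub>C \<xi>) n) = cmod c * p (\<xi> m - \<xi> n)"
        using p d unfolding seminorm_on_def by simp
      also have "\<dots> \<le> (cmod c + 1) * p (\<xi> m - \<xi> n)"
        using p d unfolding seminorm_on_def by (intro mult_right_mono) auto
      also have "\<dots> < e" using M[OF that] c by (simp add: field_simps)
      finally show ?thesis .
    qed
    then show ?thesis by blast
  qed
  then show "c *\<^sub>C \<xi> \<in> cauchy_seqs E p"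
    unfolding cauchy_seqs_def using mem complex_vector.subspace_scale[OF sub] by (simp add: scaleC_fun_def)
qed

lemma completed_seminorm_const: "completed_seminorm p (\<lambda>_. x) = p x"
  by (simp add: completed_seminorm_def)

lemma completed_seminorm_tendsto:
  assumes "csubspace E" "seminorm_on E p" "\<xi> \<in> cauchy_seqs E p"
  shows "(\<lambda>m. p (\<xi> m)) \<longlonglongrightarrow> completed_seminorm p \<xi>"
proof -
  have "Cauchy (\<lambda>m. p (\<xi> m))"
  proof (rule CauchyI')
    fix e :: real assume "e > 0"
    then obtain M where M: "\<And>m n. m \<ge> M \<Longrightarrow> n \<ge> M \<Longrightarrow> p (\<xi> m - \<xi> n) < e"
      using cauchy_seqs_tail[OF assms(3)] by blast
    have "\<bar>p (\<xi> m) - p (\<xi> n)\<bar> \<le> p (\<xi> m - \<xi> n)" for m n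
      using seminorm_on_abs_diff[OF assms(1,2)] assms(3) unfolding cauchy_seqs_def by blast
    then show "\<exists>M. \<forall>m\<ge>M. \<forall>n>m. dist (p (\<xi> m)) (p (\<xi> n)) < e"
      using M unfolding dist_real_def by (meson less_imp_le order_trans order_le_less_trans)
  qed
  then show ?thesis
    unfolding completed_seminorm_def by (simp add: Cauchy_convergent convergent_LIMSEQ_iff[symmetric])
qed

text \<open>Functionals bounded by \<open>q\<close> extend to the completion with respect to \<open>q\<close>, which consists of Cauchy
  sequences, by taking limits.\<close>

lemma functional_cauchy:
  assumes "csubspace E" "linear_map_on E a" "\<And>x. x \<in> E \<Longrightarrow> cmod (a x) \<le> C * q x" "C > 0"
    and "\<xi> \<in> cauchy_seqs E q"
  shows "(\<lambda>m. a (\<xi> m)) \<longlonglongrightarrow> lim (\<lambda>m. a (\<xi> m))"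
proof -
  have mem: "\<xi> m \<in> E" for m using assms(5) unfolding cauchy_seqs_def by blast
  have "Cauchy (\<lambda>m. a (\<xi> m))"
  proof (rule CauchyI')
    fix e :: real assume "e > 0"
    then obtain M where M: "\<And>m n. m \<ge> M \<Longrightarrow> n \<ge> M \<Longrightarrow> q (\<xi> m - \<xi> n) < e / C"
      using cauchy_seqs_tail[OF assms(5), of "e / C"] assms(4) by auto
    have "dist (a (\<xi> m)) (a (\<xi> n)) < e" if "m \<ge> M" "n \<ge> M" for m n
    proof -
      have "dist (a (\<xi> m)) (a (\<xi> n)) = cmod (a (\<xi> m - \<xi> n))"
        using linear_map_on_diff[OF assms(1,2) mem mem] by (simp add: dist_norm)
      also have "\<dots> \<le> C * q (\<xi> m - \<xi> n)"
        using assms(3) complex_vector.subspace_diff[OF assms(1) mem mem] by blast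
      also have "\<dots> < e" using M[OF that] assms(4) by (simp add: field_simps)
      finally show ?thesis .
    qed
    then show "\<exists>M. \<forall>m\<ge>M. \<forall>n>m. dist (a (\<xi> m)) (a (\<xi> n)) < e" by (meson less_imp_le order_trans)
  qed
  then show ?thesis by (simp add: Cauchy_convergent convergent_LIMSEQ_iff[symmetric])
qed

text \<open>A nuclear representation of the identity on the space itself passes to the completions. At a Cauchy
  sequence \<open>\<xi>\<close> the remainder is compared with the one at a late term \<open>x\<close> of \<open>\<xi>\<close>: the difference of the
  two finite sums is at most the sum of all \<open>|l j|\<close> times the distance from \<open>\<xi>\<close> to \<open>x\<close>, uniformly in the
  number of summands.\<close>

lemma nuclear_map_on_completions:
  assumes sub: "csubspace E" and p: "seminorm_on E p" and q: "seminorm_on E q"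
    and pq: "\<And>x. x \<in> E \<Longrightarrow> p x \<le> q x"
    and l: "summable (\<lambda>j. cmod (l j))"
    and a: "\<And>j. linear_map_on E (a j)" "\<And>j x. x \<in> E \<Longrightarrow> cmod (a j x) \<le> q x"
    and y: "\<And>j. y j \<in> E" "\<And>j. p (y j) \<le> 1"
    and expansion: "\<And>x. x \<in> E \<Longrightarrow> (\<lambda>N. p (x - (\<Sum>j<N. (l j * a j x) *\<^sub>C y j))) \<longlonglongrightarrow> 0"
  shows "nuclear_map_on (cauchy_seqs E q) (completed_seminorm q)
           (cauchy_seqs E p) (completed_seminorm p) (\<lambda>\<xi>. \<xi>)"
proof -
  define A where "A j \<xi> = lim (\<lambda>m. a j (\<xi> m))" for j \<xi>
  have mem: "\<xi> m \<in> E" if "\<xi> \<in> cauchy_seqs E q" for \<xi> m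
    using that unfolding cauchy_seqs_def by blast
  have A: "(\<lambda>m. a j (\<xi> m)) \<longlonglongrightarrow> A j \<xi>" if "\<xi> \<in> cauchy_seqs E q" for j \<xi>
    unfolding A_def using functional_cauchy[OF sub a(1), of j 1 q \<xi>] a(2) that by simp
  have "linear_map_on (cauchy_seqs E q) (A j)" for j
    unfolding linear_map_on_def
  proof (intro conjI ballI allI)
    fix \<xi> \<eta> assume X: "\<xi> \<in> cauchy_seqs E q" "\<eta> \<in> cauchy_seqs E q"
    have "a j ((\<xi> + \<eta>) m) = a j (\<xi> m) + a j (\<eta> m)" for m
      using a(1) mem X unfolding linear_map_on_def by simp
    then have "(\<lambda>m. a j ((\<xi> + \<eta>) m)) \<longlonglongrightarrow> A j \<xi> + A j \<eta>"
      using tendsto_add[OF A[OF X(1)] A[OF X(2)]] by simp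
    then show "A j (\<xi> + \<eta>) = A j \<xi> + A j \<eta>" unfolding A_def by (rule limI)
  next
    fix c \<xi> assume X: "\<xi> \<in> cauchy_seqs E q"
    have "a j ((c *\<^sub>C \<xi>) m) = c * a j (\<xi> m)" for m
      using a(1) mem X unfolding linear_map_on_def by (simp add: scaleC_fun_def scaleC_complex_def)
    then have "(\<lambda>m. a j ((c *\<^sub>C \<xi>) m)) \<longlonglongrightarrow> c * A j \<xi>"
      using tendsto_mult[OF tendsto_const A[OF X]] by simp
    then show "A j (c *\<^sub>C \<xi>) = c *\<^sub>C A j \<xi>" unfolding A_def by (simp add: limI scaleC_complex_def)
  qed
  moreover have "cmod (A j \<xi>) \<le> completed_seminorm q \<xi>" if X: "\<xi> \<in> cauchy_seqs E q" for j \<xi>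
    using a(2) mem[OF X]
    by (intro LIMSEQ_le[OF tendsto_norm[OF A[OF X]] completed_seminorm_tendsto[OF sub q X]]) auto
  moreover have "(\<lambda>_. y j) \<in> cauchy_seqs E p" "completed_seminorm p (\<lambda>_. y j) \<le> 1" for j
    using const_in_cauchy_seqs[OF sub p] y by (simp_all add: completed_seminorm_const)
  moreover have "(\<lambda>N. completed_seminorm p (\<xi> - (\<Sum>j<N. (l j * A j \<xi>) *\<^sub>C (\<lambda>_. y j)))) \<longlonglongrightarrow> 0"
    if X: "\<xi> \<in> cauchy_seqs E q" for \<xi>
  proof (rule LIMSEQ_I)
    fix e :: real assume e: "e > 0"
    define L where "L = (\<Sum>j. cmod (l j))"
    have L: "0 \<le> L" unfolding L_def using l by (intro suminf_nonneg) auto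
    define d where "d = e / (2 * (2 + L))"
    have d: "d > 0" "(2 + L) * d = e / 2" using e L by (auto simp: d_def field_simps)
    obtain M where M: "\<And>m n. m \<ge> M \<Longrightarrow> n \<ge> M \<Longrightarrow> q (\<xi> m - \<xi> n) < d"
      using cauchy_seqs_tail[OF X d(1)] by blast
    define x where "x = \<xi> M"
    have x: "x \<in> E" using mem[OF X] by (simp add: x_def)
    have Ax: "cmod (a j x - A j \<xi>) \<le> d" for j
    proof (rule LIMSEQ_le_const2)
      show "(\<lambda>m. cmod (a j x - a j (\<xi> m))) \<longlonglongrightarrow> cmod (a j x - A j \<xi>)"
        by (intro tendsto_norm tendsto_diff tendsto_const A[OF X])
      have "cmod (a j x - a j (\<xi> m)) \<le> d" if "m \<ge> M" for m
      proof -
        have "cmod (a j x - a j (\<xi> m)) = cmod (a j (x - \<xi> m))"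
          using linear_map_on_diff[OF sub a(1) x mem[OF X]] by simp
        also have "\<dots> \<le> q (x - \<xi> m)"
          using a(2) complex_vector.subspace_diff[OF sub x mem[OF X]] by blast
        also have "\<dots> \<le> d" using M[of M m] that by (simp add: x_def)
        finally show ?thesis .
      qed
      then show "\<exists>N. \<forall>n\<ge>N. cmod (a j x - a j (\<xi> n)) \<le> d" by blast
    qed
    obtain N0 where "\<forall>N\<ge>N0. norm (p (x - (\<Sum>j<N. (l j * a j x) *\<^sub>C y j)) - 0) < d"
      using LIMSEQ_D[OF expansion[OF x] d(1)] by blast
    then have N0: "p (x - (\<Sum>j<N. (l j * a j x) *\<^sub>C y j)) < d" if "N \<ge> N0" for N
      using that by (auto simp: abs_less_iff)
    have "norm (completed_seminorm p (\<xi> - (\<Sum>j<N. (l j * A j \<xi>) *\<^sub>C (\<lambda>_. y j))) - 0) < e"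
      if N: "N \<ge> N0" for N
    proof -
      define z where "z = (\<Sum>j<N. (l j * A j \<xi>) *\<^sub>C y j)"
      define u where "u = (\<Sum>j<N. (l j * a j x) *\<^sub>C y j)"
      have zE: "z \<in> E" "u \<in> E" unfolding z_def u_def
        using y(1) complex_vector.subspace_scale[OF sub]
        by (auto intro!: complex_vector.subspace_sum[OF sub])
      have \<eta>: "(\<xi> - (\<Sum>j<N. (l j * A j \<xi>) *\<^sub>C (\<lambda>_. y j))) m = \<xi> m - z" for m
        by (simp add: z_def sum_fun_apply scaleC_fun_def)
      have \<eta>q: "\<xi> - (\<Sum>j<N. (l j * A j \<xi>) *\<^sub>C (\<lambda>_. y j)) \<in> cauchy_seqs E p"
        using cauchy_seqs_mono[OF sub pq X] const_in_cauchy_seqs[OF sub p y(1)]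
          complex_vector.subspace_scale[OF csubspace_cauchy_seqs[OF sub p]]
        by (intro complex_vector.subspace_diff[OF csubspace_cauchy_seqs[OF sub p]]
            complex_vector.subspace_sum[OF csubspace_cauchy_seqs[OF sub p]]) auto
      have uz: "p (u - z) \<le> L * d"
      proof -
        have "u - z = (\<Sum>j<N. (l j * (a j x - A j \<xi>)) *\<^sub>C y j)"
          by (simp add: u_def z_def sum_subtractf[symmetric] right_diff_distrib
              complex_vector.scale_left_diff_distrib)
        also have "p \<dots> \<le> (\<Sum>j<N. p ((l j * (a j x - A j \<xi>)) *\<^sub>C y j))"
          using y(1) complex_vector.subspace_scale[OF sub] by (intro seminorm_on_sum[OF sub p]) auto
        also have "\<dots> = (\<Sum>j<N. cmod (l j * (a j x - A j \<xi>)) * p (y j))"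
          using p y(1) unfolding seminorm_on_def by simp
        also have "\<dots> \<le> (\<Sum>j<N. cmod (l j) * d * 1)"
          unfolding norm_mult using Ax y d p by (intro sum_mono mult_mono) (auto simp: seminorm_on_def)
        also have "\<dots> = (\<Sum>j<N. cmod (l j)) * d" by (simp add: sum_distrib_right)
        also have "\<dots> \<le> L * d"
          unfolding L_def using d l by (intro mult_right_mono sum_le_suminf) auto
        finally show ?thesis .
      qed
      have b: "p (\<xi> m - z) \<le> (2 + L) * d" if m: "m \<ge> M" for m
      proof -
        have "p (\<xi> m - z) \<le> p (\<xi> m - x) + p (x - z)"
          by (rule seminorm_on_triangle_diff[OF sub p mem[OF X] x zE(1)])
        moreover have "p (x - z) \<le> p (x - u) + p (u - z)"
          by (rule seminorm_on_triangle_diff[OF sub p x zE(2,1)])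
        moreover have "p (\<xi> m - x) \<le> q (\<xi> m - x)"
          using pq complex_vector.subspace_diff[OF sub mem[OF X] x] by blast
        moreover have "q (\<xi> m - x) < d" using M[OF m, of M] by (simp add: x_def)
        moreover have "p (x - u) < d" using N0[OF N] by (simp add: u_def)
        ultimately show ?thesis using uz by (simp add: distrib_right)
      qed
      have lim: "(\<lambda>m. p (\<xi> m - z)) \<longlonglongrightarrow> completed_seminorm p (\<xi> - (\<Sum>j<N. (l j * A j \<xi>) *\<^sub>C (\<lambda>_. y j)))"
        using completed_seminorm_tendsto[OF sub p \<eta>q] unfolding \<eta> .
      have "completed_seminorm p (\<xi> - (\<Sum>j<N. (l j * A j \<xi>) *\<^sub>C (\<lambda>_. y j))) \<le> (2 + L) * d"
        by (rule LIMSEQ_le_const2[OF lim]) (use b in blast)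
      moreover have "0 \<le> completed_seminorm p (\<xi> - (\<Sum>j<N. (l j * A j \<xi>) *\<^sub>C (\<lambda>_. y j)))"
        using p complex_vector.subspace_diff[OF sub mem[OF X] zE(1)]
        by (intro LIMSEQ_le_const[OF lim]) (auto simp: seminorm_on_def)
      ultimately show ?thesis using d e by simp
    qed
    then show "\<exists>N0. \<forall>N\<ge>N0. norm (completed_seminorm p (\<xi> - (\<Sum>j<N. (l j * A j \<xi>) *\<^sub>C (\<lambda>_. y j))) - 0) < e"
      by blast
  qed
  ultimately show ?thesis
    unfolding nuclear_map_on_def using l
    by (intro exI[of _ l] exI[of _ A] exI[of _ "\<lambda>j _. y j"]) blast
qed

text \<open>Write the identity as \<open>\<Sum>\<^sub>j l\<^sub>j a\<^sub>j \<otimes> y\<^sub>j\<close>. Then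
  \<open>\<Sum>\<^sub>n f\<^sub>n(e\<^sub>n) = \<Sum>\<^sub>j l\<^sub>j a\<^sub>j(\<Sum>\<^sub>n f\<^sub>n(y\<^sub>j) e\<^sub>n)\<close>, and as \<open>y\<^sub>j\<close> lies in the unit ball of \<open>p\<close>, the
  coefficients \<open>f\<^sub>n(y\<^sub>j)\<close> are bounded by \<open>c\<^sub>n\<close>. So \<open>D\<close> bounds each value of \<open>a\<^sub>j\<close>, and \<open>L\<close> is the sum
  of the \<open>|l\<^sub>j|\<close>, independent of the biorthogonal system. For \<open>n\<close> unit vectors with their coordinate
  functionals the left side equals \<open>n\<close>.\<close>

lemma nuclear_map_trace_bound:
  assumes sub: "csubspace E" and p: "seminorm_on E p" and q: "seminorm_on E q"
    and nuc: "nuclear_map_on (cauchy_seqs E q) (completed_seminorm q)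
           (cauchy_seqs E p) (completed_seminorm p) (\<lambda>\<xi>. \<xi>)"
  obtains L where "0 \<le> L"
    "\<And>(e :: nat \<Rightarrow> 'v::complex_vector) f c D B. finite B \<Longrightarrow> (\<And>n. n \<in> B \<Longrightarrow> e n \<in> E) \<Longrightarrow>
      (\<And>n. n \<in> B \<Longrightarrow> linear_map_on E (f n)) \<Longrightarrow> (\<And>n. n \<in> B \<Longrightarrow> 0 < c n) \<Longrightarrow>
      (\<And>n x. n \<in> B \<Longrightarrow> x \<in> E \<Longrightarrow> cmod (f n x) \<le> c n * p x) \<Longrightarrow>
      (\<And>z. (\<And>n. n \<in> B \<Longrightarrow> cmod (z n) \<le> c n) \<Longrightarrow> q (\<Sum>n\<in>B. z n *\<^sub>C e n) \<le> D) \<Longrightarrow>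
      cmod (\<Sum>n\<in>B. f n (e n)) \<le> L * D"
proof -
  obtain l :: "nat \<Rightarrow> complex" and a y where "summable (\<lambda>j. cmod (l j)) \<and>
        (\<forall>j. linear_map_on (cauchy_seqs E q) (a j) \<and>
          (\<forall>\<xi>\<in>cauchy_seqs E q. cmod (a j \<xi>) \<le> completed_seminorm q \<xi>)) \<and>
        (\<forall>j. y j \<in> cauchy_seqs E p \<and> completed_seminorm p (y j) \<le> 1) \<and>
        (\<forall>\<xi>\<in>cauchy_seqs E q.
          (\<lambda>N. completed_seminorm p (\<xi> - (\<Sum>j<N. (l j * a j \<xi>) *\<^sub>C y j))) \<longlonglongrightarrow> 0)"
    using nuc unfolding nuclear_map_on_def by (elim exE) (rule that)
  then have l: "summable (\<lambda>j. cmod (l j))"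
    and a: "\<And>j. linear_map_on (cauchy_seqs E q) (a j)"
      "\<And>j \<xi>. \<xi> \<in> cauchy_seqs E q \<Longrightarrow> cmod (a j \<xi>) \<le> completed_seminorm q \<xi>"
    and y: "\<And>j. y j \<in> cauchy_seqs E p" "\<And>j. completed_seminorm p (y j) \<le> 1"
    and expansion: "\<And>\<xi>. \<xi> \<in> cauchy_seqs E q \<Longrightarrow>
      (\<lambda>N. completed_seminorm p (\<xi> - (\<Sum>j<N. (l j * a j \<xi>) *\<^sub>C y j))) \<longlonglongrightarrow> 0"
    by blast+
  define L where "L = (\<Sum>j. cmod (l j))"
  have L: "0 \<le> L" unfolding L_def using l by (intro suminf_nonneg) auto
  have yE: "y j m \<in> E" for j m using y(1) unfolding cauchy_seqs_def by blast
  have "cmod (\<Sum>n\<in>B. f n (e n)) \<le> L * D"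
    if B: "finite B" and e: "\<And>n. n \<in> B \<Longrightarrow> e n \<in> E" and f: "\<And>n. n \<in> B \<Longrightarrow> linear_map_on E (f n)"
      and c: "\<And>n. n \<in> B \<Longrightarrow> 0 < c n" "\<And>n x. n \<in> B \<Longrightarrow> x \<in> E \<Longrightarrow> cmod (f n x) \<le> c n * p x"
      and D: "\<And>z. (\<And>n. n \<in> B \<Longrightarrow> cmod (z n) \<le> c n) \<Longrightarrow> q (\<Sum>n\<in>B. z n *\<^sub>C e n) \<le> D"
    for e :: "nat \<Rightarrow> 'v" and f c D B
  proof -
    have const: "(\<lambda>_. x) \<in> cauchy_seqs E q" if "x \<in> E" for x
      using const_in_cauchy_seqs[OF sub q that] .
    define b where "b j x = a j (\<lambda>_. x)" for j x
    have b_lin: "linear_map_on E (b j)" for j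
      unfolding linear_map_on_def b_def
    proof (intro conjI ballI allI)
      fix x x' assume "x \<in> E" "x' \<in> E"
      then have "a j ((\<lambda>_. x) + (\<lambda>_. x')) = a j (\<lambda>_. x) + a j (\<lambda>_. x')"
        using a(1) const unfolding linear_map_on_def by blast
      then show "a j (\<lambda>_. x + x') = a j (\<lambda>_. x) + a j (\<lambda>_. x')" by (simp add: plus_fun_def)
    next
      fix k x assume "x \<in> E"
      then have "a j (k *\<^sub>C (\<lambda>_. x)) = k *\<^sub>C a j (\<lambda>_. x)"
        using a(1) const unfolding linear_map_on_def by blast
      then show "a j (\<lambda>_. k *\<^sub>C x) = k *\<^sub>C a j (\<lambda>_. x)" by (simp add: scaleC_fun_def)
    qed
    have b: "cmod (b j x) \<le> q x" if "x \<in> E" for j x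
      using a(2)[OF const[OF that]] by (simp add: b_def completed_seminorm_const)
    define g where "g n j = lim (\<lambda>m. f n (y j m))" for n j
    have g: "(\<lambda>m. f n (y j m)) \<longlonglongrightarrow> g n j" if "n \<in> B" for n j
      unfolding g_def using functional_cauchy[OF sub f[OF that] c(2)[OF that] c(1)[OF that] y(1)] .
    have g_le: "cmod (g n j) \<le> c n" if n: "n \<in> B" for n j
    proof -
      have "cmod (g n j) \<le> c n * completed_seminorm p (y j)"
        using c(2)[OF n yE]
        by (intro LIMSEQ_le[OF tendsto_norm[OF g[OF n]]
              tendsto_mult[OF tendsto_const completed_seminorm_tendsto[OF sub p y(1)]]]) auto
      also have "\<dots> \<le> c n * 1" using c(1)[OF n] y(2) by (intro mult_left_mono) auto
      finally show ?thesis by simp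
    qed
    have expand: "(\<lambda>N. \<Sum>j<N. l j * b j (e n) * g n j) \<longlonglongrightarrow> f n (e n)" if n: "n \<in> B" for n
    proof -
      let ?r = "\<lambda>N. (\<lambda>_. e n) - (\<Sum>j<N. (l j * a j (\<lambda>_. e n)) *\<^sub>C y j)"
      have le: "cmod (f n (e n) - (\<Sum>j<N. l j * b j (e n) * g n j)) \<le> c n * completed_seminorm p (?r N)" for N
      proof -
        have r: "?r N m = e n - (\<Sum>j<N. (l j * b j (e n)) *\<^sub>C y j m)" for m
          by (simp add: sum_fun_apply scaleC_fun_def b_def)
        have rE: "?r N m \<in> E" for m
          unfolding r using e[OF n] yE complex_vector.subspace_scale[OF sub]
          by (intro complex_vector.subspace_diff[OF sub] complex_vector.subspace_sum[OF sub]) auto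
        have fr: "f n (?r N m) = f n (e n) - (\<Sum>j<N. l j * b j (e n) * f n (y j m))" for m
        proof -
          have "(\<Sum>j<N. (l j * b j (e n)) *\<^sub>C y j m) \<in> E"
            using yE complex_vector.subspace_scale[OF sub]
            by (intro complex_vector.subspace_sum[OF sub]) auto
          then show ?thesis
            unfolding r using linear_map_on_diff[OF sub f[OF n] e[OF n]]
              linear_map_on_sum[OF sub f[OF n], of "{..<N}" "\<lambda>j. y j m" "\<lambda>j. l j * b j (e n)"] yE
            by (simp add: scaleC_complex_def)
        qed
        have "?r N \<in> cauchy_seqs E p"
          using const_in_cauchy_seqs[OF sub p e[OF n]] y(1)
            complex_vector.subspace_scale[OF csubspace_cauchy_seqs[OF sub p]]
          by (intro complex_vector.subspace_diff[OF csubspace_cauchy_seqs[OF sub p]]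
              complex_vector.subspace_sum[OF csubspace_cauchy_seqs[OF sub p]]) auto
        from completed_seminorm_tendsto[OF sub p this]
        have lim1: "(\<lambda>m. c n * p (?r N m)) \<longlonglongrightarrow> c n * completed_seminorm p (?r N)"
          by (intro tendsto_mult tendsto_const)
        have lim2: "(\<lambda>m. cmod (f n (?r N m))) \<longlonglongrightarrow> cmod (f n (e n) - (\<Sum>j<N. l j * b j (e n) * g n j))"
          unfolding fr by (intro tendsto_norm tendsto_diff tendsto_const tendsto_sum tendsto_mult g n)
        show ?thesis by (rule LIMSEQ_le[OF lim2 lim1]) (use c(2)[OF n rE] in blast)
      qed
      have "(\<lambda>N. c n * completed_seminorm p (?r N)) \<longlonglongrightarrow> c n * 0"
        using expansion[OF const[OF e[OF n]]] by (intro tendsto_mult tendsto_const)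
      then have "(\<lambda>N. c n * completed_seminorm p (?r N)) \<longlonglongrightarrow> 0" by simp
      from Lim_null_comparison[OF always_eventually[OF allI[OF le]] this]
      have "(\<lambda>N. f n (e n) - (\<Sum>j<N. l j * b j (e n) * g n j)) \<longlonglongrightarrow> 0" .
      from tendsto_diff[OF tendsto_const[of "f n (e n)"] this] show ?thesis by simp
    qed
    have lim: "(\<lambda>N. \<Sum>n\<in>B. \<Sum>j<N. l j * b j (e n) * g n j) \<longlonglongrightarrow> (\<Sum>n\<in>B. f n (e n))"
      by (intro tendsto_sum expand)
    have D0: "0 \<le> D"
    proof -
      have "q (\<Sum>n\<in>B. 0 *\<^sub>C e n) \<le> D" using c(1) by (intro D) (simp add: less_imp_le)
      then show ?thesis using seminorm_on_zero[OF sub q] by simp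
    qed
    have "cmod (\<Sum>n\<in>B. \<Sum>j<N. l j * b j (e n) * g n j) \<le> L * D" for N
    proof -
      have "(\<Sum>n\<in>B. \<Sum>j<N. l j * b j (e n) * g n j) = (\<Sum>j<N. l j * (\<Sum>n\<in>B. g n j * b j (e n)))"
        by (subst sum.swap) (simp add: sum_distrib_left mult_ac)
      also have "\<dots> = (\<Sum>j<N. l j * b j (\<Sum>n\<in>B. g n j *\<^sub>C e n))"
      proof (rule sum.cong[OF refl])
        fix j
        have "b j (\<Sum>n\<in>B. g n j *\<^sub>C e n) = (\<Sum>n\<in>B. g n j *\<^sub>C b j (e n))"
          by (rule linear_map_on_sum[OF sub b_lin B e])
        then show "l j * (\<Sum>n\<in>B. g n j * b j (e n)) = l j * b j (\<Sum>n\<in>B. g n j *\<^sub>C e n)"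
          by (simp add: scaleC_complex_def)
      qed
      also have "cmod \<dots> \<le> (\<Sum>j<N. cmod (l j) * D)"
      proof (rule sum_norm_le)
        fix j
        have "(\<Sum>n\<in>B. g n j *\<^sub>C e n) \<in> E"
          using e complex_vector.subspace_scale[OF sub] by (intro complex_vector.subspace_sum[OF sub]) auto
        then have "cmod (b j (\<Sum>n\<in>B. g n j *\<^sub>C e n)) \<le> q (\<Sum>n\<in>B. g n j *\<^sub>C e n)" by (rule b)
        also have "\<dots> \<le> D" using g_le by (intro D) auto
        finally show "cmod (l j * b j (\<Sum>n\<in>B. g n j *\<^sub>C e n)) \<le> cmod (l j) * D"
          by (simp add: norm_mult mult_left_mono)
      qed
      also have "\<dots> = (\<Sum>j<N. cmod (l j)) * D" by (simp add: sum_distrib_right)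
      also have "\<dots> \<le> L * D" unfolding L_def using D0 l by (intro mult_right_mono sum_le_suminf) auto
      finally show ?thesis .
    qed
    then show ?thesis by (intro LIMSEQ_le_const2[OF tendsto_norm[OF lim]]) blast
  qed
  note main = this
  show ?thesis
  proof (rule that[OF L], goal_cases)
    case 1
    then show ?case by (rule main)
  qed
qed

section \<open>Nuclearity of \<open>E\<^sub>\<alpha>\<close>\<close>

context power_series_dual
begin

lemma truncation_tendsto_0:
  assumes p: "continuous_seminorm (E_space \<alpha> s) p" and x: "x \<in> E"
  shows "(\<lambda>N. p (x - (\<Sum>n<N. x n *\<^sub>C unit_seq n))) \<longlonglongrightarrow> 0"
proof -
  obtain k where k: "x \<in> c0 (v k)" using x unfolding E_def by blast
  have sp: "seminorm_on E p" using p continuous_seminorm_E_space_iff by blast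
  obtain C where C: "\<And>x. x \<in> c0 (v k) \<Longrightarrow> p x \<le> C * c0_norm (v k) x"
    using p continuous_seminorm_E_space_iff by blast
  have mem: "x - (\<Sum>n<N. x n *\<^sub>C unit_seq n) \<in> c0 (v k)" for N
    using k step.unit_seq(1) by (intro complex_vector.subspace_diff[OF step.csubspace_c0]
        complex_vector.subspace_sum[OF step.csubspace_c0] complex_vector.subspace_scale[OF step.csubspace_c0])
  have "(\<lambda>N. C * c0_norm (v k) (x - (\<Sum>n<N. x n *\<^sub>C unit_seq n))) \<longlonglongrightarrow> C * 0"
    by (intro tendsto_mult tendsto_const step.truncation_tendsto k)
  then have lim: "(\<lambda>N. C * c0_norm (v k) (x - (\<Sum>n<N. x n *\<^sub>C unit_seq n))) \<longlonglongrightarrow> 0" by simp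
  have "0 \<le> p (x - (\<Sum>n<N. x n *\<^sub>C unit_seq n))" for N
    using sp mem[of N] unfolding seminorm_on_def E_def by blast
  then show ?thesis
    using C[OF mem] by (intro tendsto_sandwich[OF _ _ tendsto_const lim] always_eventually allI)
qed

text \<open>For a continuous seminorm \<open>p\<close>, the numbers \<open>p (unit_seq n)\<close> decay faster than every
  \<open>r powr (- \<alpha> n)\<close>. Under the growth condition this remains true after multiplication by powers of \<open>n + 1\<close>.
  Two of them are spent on the coefficients \<open>1 / (n + 1)^2\<close> of the nuclear representation, two more on the
  convergence of the series \<open>q\<close>.\<close>

lemma log_dominated_imp_nuclear:
  assumes log_dominated shows "nuclear_space (E_space \<alpha> s)"
  unfolding nuclear_space_def
proof (intro conjI allI impI)
  show "locally_convex (E_space \<alpha> s)"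
    using E_space_admissible by (simp add: ind_admissible_def)
  fix p assume p: "continuous_seminorm (E_space \<alpha> s) p"
  then have sp: "seminorm_on E p" and pC: "\<And>k. \<exists>C. \<forall>x\<in>c0 (v k). p x \<le> C * c0_norm (v k) x"
    using continuous_seminorm_E_space_iff by blast+
  define e where "e n = p (unit_seq n)" for n
  have e0: "0 \<le> e n" for n using sp unit_seq_in_E unfolding e_def seminorm_on_def by blast
  define b where "b n = real (n + 1) ^ 2 * e n" for n
  have b0: "0 \<le> b n" for n using e0 by (simp add: b_def)
  have inv2: "summable (\<lambda>n. 1 / real (n + 1) ^ 2)"
    using inverse_power_summable[of 2, where ?'a = real] summable_Suc_iff[of "\<lambda>n. 1 / real n ^ 2"]
    by (simp add: inverse_eq_divide)
  have step_sum: "\<exists>D. \<forall>x\<in>c0 (v k). \<forall>n. b n * cmod (x n) \<le> D * c0_norm (v k) x * (1 / real (n + 1) ^ 2)" for k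
  proof -
    obtain r where r: "r \<ge> 1" "\<And>n. real (n + 1) ^ 4 \<le> r powr \<alpha> n"
      using polynomial_dominated[OF assms] by blast
    obtain j where j: "r * s k < s j" using exists_s_gt by blast
    obtain C where C: "\<And>x. x \<in> c0 (v j) \<Longrightarrow> p x \<le> C * c0_norm (v j) x" using pC by blast
    have C0: "e n \<le> C * v j n" for n
      using C[OF step.unit_seq(1)] by (simp add: e_def step.unit_seq(2))
    have Cpos: "0 \<le> C"
      using order_trans[OF e0[of 0] C0[of 0]] step.pos[of j 0] by (simp add: zero_le_mult_iff)
    have "b n * cmod (x n) \<le> C * c0_norm (v k) x * (1 / real (n + 1) ^ 2)" if x: "x \<in> c0 (v k)" for x n
    proof -
      have nx: "0 \<le> c0_norm (v k) x" using step.seminorm x unfolding seminorm_on_def by blast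
      have "v j n * s k powr \<alpha> n * real (n + 1) ^ 4 \<le> v j n * s k powr \<alpha> n * r powr \<alpha> n"
        using r step.pos[of j n] by (intro mult_left_mono) auto
      also have "\<dots> = v j n * (r * s k) powr \<alpha> n"
        using r s_gt_1[of k] by (simp add: powr_mult mult_ac)
      also have "\<dots> \<le> v j n * s j powr \<alpha> n"
        using r s_gt_1[of k] j step.pos[of j n] alpha_pos[of n]
        by (intro mult_left_mono powr_mono2) auto
      finally have key: "v j n * s k powr \<alpha> n * real (n + 1) ^ 4 \<le> 1" by (simp add: weight_mult)
      have "e n * cmod (x n) \<le> (C * v j n) * (c0_norm (v k) x * s k powr \<alpha> n)"
        using C0 coordinate_bound[OF x] Cpos step.pos[of j n] by (intro mult_mono) auto
      then have "e n * cmod (x n) * real (n + 1) ^ 4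
          \<le> C * v j n * (c0_norm (v k) x * s k powr \<alpha> n) * real (n + 1) ^ 4"
        by (intro mult_right_mono) auto
      also have "\<dots> = C * c0_norm (v k) x * (v j n * s k powr \<alpha> n * real (n + 1) ^ 4)" by (simp add: mult_ac)
      also have "\<dots> \<le> C * c0_norm (v k) x * 1" using key Cpos nx by (intro mult_left_mono) auto
      finally have "e n * cmod (x n) * real (n + 1) ^ 4 \<le> C * c0_norm (v k) x" by simp
      moreover have "e n * cmod (x n) * real (n + 1) ^ 4 = b n * cmod (x n) * real (n + 1) ^ 2"
        by (simp add: b_def power4_eq_xxxx power2_eq_square)
      ultimately have "b n * cmod (x n) * real (n + 1) ^ 2 \<le> C * c0_norm (v k) x" by linarith
      moreover have "0 < real (n + 1) ^ 2" by simp
      ultimately show ?thesis by (simp only: pos_le_divide_eq times_divide_eq_right mult_1_right)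
    qed
    then show ?thesis by blast
  qed
  define q where "q x = (\<Sum>n. b n * cmod (x n))" for x :: "nat \<Rightarrow> complex"
  have summ: "summable (\<lambda>n. b n * cmod (x n))" if x: "x \<in> E" for x
  proof -
    obtain k where k: "x \<in> c0 (v k)" using x unfolding E_def by blast
    obtain D where "\<And>n. b n * cmod (x n) \<le> D * c0_norm (v k) x * (1 / real (n + 1) ^ 2)"
      using step_sum[of k] k by blast
    then show ?thesis
      using b0 by (intro summable_comparison_test'[OF summable_mult[OF inv2]]) (auto simp: abs_mult)
  qed
  have q_term: "b n * cmod (x n) \<le> q x" if "x \<in> E" for x n
    using sum_le_suminf[OF summ[OF that], of "{n}"] b0 by (simp add: q_def)
  have sq: "seminorm_on E q"
    unfolding seminorm_on_def
  proof (intro conjI ballI allI)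
    fix x assume x: "x \<in> E"
    show "0 \<le> q x" unfolding q_def using b0 by (intro suminf_nonneg summ x) auto
    fix y assume y: "y \<in> E"
    have "q (x + y) \<le> (\<Sum>n. b n * cmod (x n) + b n * cmod (y n))"
      unfolding q_def
    proof (rule suminf_le)
      show "b n * cmod ((x + y) n) \<le> b n * cmod (x n) + b n * cmod (y n)" for n
        using mult_left_mono[OF norm_triangle_ineq b0] by (simp add: distrib_left)
    qed (use x y summ complex_vector.subspace_add[OF csubspace_E] summable_add in blast)+
    then show "q (x + y) \<le> q x + q y" unfolding q_def by (simp add: suminf_add[OF summ[OF x] summ[OF y]])
  next
    fix c x assume "x \<in> E"
    then show "q (c *\<^sub>C x) = cmod c * q x"
      unfolding q_def using suminf_mult[OF summ, of x "cmod c"] by (simp add: norm_mult mult_ac)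
  qed
  have "\<exists>C. \<forall>x\<in>c0 (v k). q x \<le> C * c0_norm (v k) x" for k
  proof -
    obtain D where D: "\<And>x n. x \<in> c0 (v k) \<Longrightarrow> b n * cmod (x n) \<le> D * c0_norm (v k) x * (1 / real (n + 1) ^ 2)"
      using step_sum[of k] by blast
    have "q x \<le> D * (\<Sum>n. 1 / real (n + 1) ^ 2) * c0_norm (v k) x" if x: "x \<in> c0 (v k)" for x
    proof -
      have "x \<in> E" using x unfolding E_def by blast
      then have "q x \<le> (\<Sum>n. D * c0_norm (v k) x * (1 / real (n + 1) ^ 2))"
        unfolding q_def using D[OF x] by (intro suminf_le summ summable_mult inv2)
      then show ?thesis using suminf_mult[OF inv2, of "D * c0_norm (v k) x"] by (simp add: mult_ac)
    qed
    then show ?thesis by blast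
  qed
  then have q: "continuous_seminorm (E_space \<alpha> s) q"
    using sq continuous_seminorm_E_space_iff by blast
  have pq: "p x \<le> q x" if x: "x \<in> E" for x
  proof (rule LIMSEQ_le_const)
    let ?t = "\<lambda>N. \<Sum>n<N. x n *\<^sub>C unit_seq n"
    have "(\<lambda>N. p (x - ?t N) + q x) \<longlonglongrightarrow> 0 + q x"
      by (intro tendsto_add tendsto_const truncation_tendsto_0 p x)
    then show "(\<lambda>N. p (x - ?t N) + q x) \<longlonglongrightarrow> q x" by simp
    have "p x \<le> p (x - ?t N) + q x" for N
    proof -
      have tE: "?t N \<in> E"
        using unit_seq_in_E complex_vector.subspace_scale[OF csubspace_E]
        by (intro complex_vector.subspace_sum[OF csubspace_E]) auto
      have "p x \<le> p (x - ?t N) + p (?t N)"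
        using seminorm_on_triangle_diff[OF csubspace_E sp x tE complex_vector.subspace_0[OF csubspace_E]] by simp
      moreover have "p (?t N) \<le> (\<Sum>n<N. p (x n *\<^sub>C unit_seq n))"
        using unit_seq_in_E complex_vector.subspace_scale[OF csubspace_E]
        by (intro seminorm_on_sum[OF csubspace_E sp]) auto
      moreover have "(\<Sum>n<N. p (x n *\<^sub>C unit_seq n)) \<le> (\<Sum>n<N. b n * cmod (x n))"
      proof (rule sum_mono)
        fix n
        have "1 * e n \<le> real (n + 1) ^ 2 * e n" using e0 by (intro mult_right_mono) auto
        then have "e n \<le> b n" by (simp add: b_def)
        then have "cmod (x n) * e n \<le> cmod (x n) * b n" by (intro mult_left_mono) auto
        moreover have "p (x n *\<^sub>C unit_seq n) = cmod (x n) * p (unit_seq n)"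
          using sp unit_seq_in_E unfolding seminorm_on_def by blast
        ultimately show "p (x n *\<^sub>C unit_seq n) \<le> b n * cmod (x n)" by (simp add: e_def mult.commute)
      qed
      moreover have "(\<Sum>n<N. b n * cmod (x n)) \<le> q x"
        unfolding q_def using b0 by (intro sum_le_suminf summ x) auto
      ultimately show ?thesis by linarith
    qed
    then show "\<exists>N0. \<forall>N\<ge>N0. p x \<le> p (x - ?t N) + q x" by blast
  qed
  define l where "l n = complex_of_real (1 / real (n + 1) ^ 2)" for n
  define a where "a n x = complex_of_real (b n) * x n" for n and x :: "nat \<Rightarrow> complex"
  \<comment> \<open>If \<open>e n = 0\<close>, division by zero makes \<open>y n\<close> vanish; the missing term lies in the kernel of \<open>p\<close>.\<close>
  define y where "y n = complex_of_real (1 / e n) *\<^sub>C unit_seq n" for n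
  have "nuclear_map_on (cauchy_seqs E q) (completed_seminorm q)
      (cauchy_seqs E p) (completed_seminorm p) (\<lambda>\<xi>. \<xi>)"
  proof (rule nuclear_map_on_completions[OF csubspace_E sp sq pq])
    show "summable (\<lambda>j. cmod (l j))" using inv2 unfolding l_def norm_of_real by simp
    show "linear_map_on E (a j)" for j
      by (simp add: linear_map_on_def a_def distrib_left mult_ac scaleC_complex_def)
    show "cmod (a j x) \<le> q x" if "x \<in> E" for j x
      using q_term[OF that, of j] b0[of j] by (simp add: a_def norm_mult)
    show "y j \<in> E" for j
      unfolding y_def using unit_seq_in_E complex_vector.subspace_scale[OF csubspace_E] by blast
    have "p (y j) = cmod (complex_of_real (1 / e j)) * p (unit_seq j)" for j
      using sp unit_seq_in_E unfolding seminorm_on_def y_def by blast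
    then show "p (y j) \<le> 1" for j
      using e0[of j] unfolding norm_of_real e_def[symmetric] by simp
    fix x assume x: "x \<in> E"
    let ?t = "\<lambda>N. \<Sum>n<N. x n *\<^sub>C unit_seq n"
    let ?u = "\<lambda>N. \<Sum>n<N. (l n * a n x) *\<^sub>C y n"
    have tE: "?t N \<in> E" "?u N \<in> E" for N
      using unit_seq_in_E complex_vector.subspace_scale[OF csubspace_E] unfolding y_def
      by (auto intro!: complex_vector.subspace_sum[OF csubspace_E])
    have "p (?t N - ?u N) \<le> 0" for N
    proof -
      have term0: "p (x n *\<^sub>C unit_seq n - (l n * a n x) *\<^sub>C y n) = 0" for n
      proof (cases "e n = 0")
        case True
        then have "y n = 0" by (simp add: y_def)
        moreover have "p (x n *\<^sub>C unit_seq n) = cmod (x n) * p (unit_seq n)"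
          using sp unit_seq_in_E unfolding seminorm_on_def by blast
        ultimately show ?thesis using True by (simp add: e_def)
      next
        case False
        have "l n * complex_of_real (b n) * complex_of_real (1 / e n)
            = complex_of_real (1 / real (n + 1) ^ 2 * (real (n + 1) ^ 2 * e n) * (1 / e n))"
          unfolding l_def b_def by (simp only: of_real_mult)
        also have "\<dots> = 1" using False by simp
        finally have one: "l n * complex_of_real (b n) * complex_of_real (1 / e n) = 1" .
        have "(l n * a n x) *\<^sub>C y n = (l n * complex_of_real (b n) * complex_of_real (1 / e n) * x n) *\<^sub>C unit_seq n"
          unfolding a_def y_def complex_vector.scale_scale by (simp only: mult_ac)
        then have "(l n * a n x) *\<^sub>C y n = x n *\<^sub>C unit_seq n" unfolding one by simp
        then show ?thesis using seminorm_on_zero[OF csubspace_E sp] by simp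
      qed
      have "p (\<Sum>n<N. x n *\<^sub>C unit_seq n - (l n * a n x) *\<^sub>C y n)
          \<le> (\<Sum>n<N. p (x n *\<^sub>C unit_seq n - (l n * a n x) *\<^sub>C y n))"
        using unit_seq_in_E complex_vector.subspace_scale[OF csubspace_E]
        unfolding y_def
        by (intro seminorm_on_sum[OF csubspace_E sp] complex_vector.subspace_diff[OF csubspace_E]) auto
      then show ?thesis unfolding term0 sum_subtractf by simp
    qed
    then have "p (x - ?u N) \<le> p (x - ?t N)" for N
      using seminorm_on_triangle_diff[OF csubspace_E sp x tE(1)[of N] tE(2)[of N]] by (smt (verit))
    moreover have "0 \<le> p (x - ?u N)" for N
      using sp complex_vector.subspace_diff[OF csubspace_E x tE(2)] unfolding seminorm_on_def by blast
    ultimately show "(\<lambda>N. p (x - ?u N)) \<longlonglongrightarrow> 0"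
      by (intro tendsto_sandwich[OF _ _ tendsto_const truncation_tendsto_0[OF p x]] always_eventually allI)
  qed
  then show "\<exists>q. continuous_seminorm (E_space \<alpha> s) q \<and> (\<forall>x\<in>topspace (E_space \<alpha> s). p x \<le> q x) \<and>
      nuclear_map_on (cauchy_seqs (topspace (E_space \<alpha> s)) q) (completed_seminorm q)
        (cauchy_seqs (topspace (E_space \<alpha> s)) p) (completed_seminorm p) (\<lambda>\<xi>. \<xi>)"
    using q pq unfolding topspace_E_space by blast
qed

text \<open>The first index at which \<open>g\<close> exceeds its maximum over an initial segment is a record.\<close>

lemma exists_record:
  fixes g :: "nat \<Rightarrow> real"
  assumes "\<And>K. \<exists>n. g n > K"
  shows "\<exists>n\<ge>N. \<forall>m\<le>n. g m \<le> g n"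
proof -
  define K where "K = Max (g ` {..N})"
  have K: "g m \<le> K" if "m \<le> N" for m unfolding K_def using that by (intro Max_ge) auto
  define n where "n = (LEAST n. g n > K)"
  have n: "g n > K" unfolding n_def using assms by (rule LeastI_ex)
  have less: "g m \<le> K" if "m < n" for m using not_less_Least[of m "\<lambda>n. g n > K"] that by (simp add: n_def not_less)
  have "g m \<le> g n" if "m \<le> n" for m
    using less[of m] n that by (cases "m = n") auto
  moreover have "n \<ge> N" using n K by (meson not_le less_imp_le)
  ultimately show ?thesis by blast
qed

text \<open>The weights \<open>w n = exp (- t n * \<alpha> n)\<close> define a continuous norm on the space as soon as \<open>t\<close> tends
  to infinity. On the first step a continuous seminorm is at most \<open>C\<close> times the norm of the step, so the trace of the
  identity on the first \<open>N + 1\<close> coordinates gives \<open>N + 1 \<le> L * C * exp (t N * \<alpha> N)\<close>. If the growth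
  condition fails, then \<open>t\<close> can be taken as half the running maximum of \<open>ln (n + 1) / \<alpha> n\<close>; at an index
  where that quotient attains its running maximum the right hand side is \<open>L * C * sqrt (N + 1)\<close>, which
  bounds these indices, although there are infinitely many of them.\<close>

lemma nuclear_imp_log_dominated:
  assumes nuc: "nuclear_space (E_space \<alpha> s)" shows log_dominated
proof (rule ccontr)
  assume not: "\<not> log_dominated"
  define g where "g n = ln (real (n + 1)) / \<alpha> n" for n
  have unb: "\<exists>n. g n > K" for K
    using not alpha_pos unfolding log_dominated_def g_def by (force simp: field_simps not_le)
  have g0: "0 \<le> g n" for n using alpha_pos[of n] by (simp add: g_def less_imp_le)
  define t where "t n = Max (g ` {..n}) / 2" for n
  have t_ge: "g m / 2 \<le> t n" if "m \<le> n" for m n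
    unfolding t_def using that by (intro divide_right_mono Max_ge) auto
  have t_mono: "t m \<le> t n" if "m \<le> n" for m n
    unfolding t_def using that by (intro divide_right_mono Max_mono) auto
  have t0: "0 \<le> t n" for n using t_ge[of n n] g0[of n] by linarith
  define w where "w n = exp (- t n * \<alpha> n)" for n
  interpret w: positive_weight w by unfold_locales (simp add: w_def)
  have wD: "\<exists>D. \<forall>n. w n \<le> D * v k n" for k
  proof -
    obtain n0 where n0: "g n0 > 2 * ln (s k)" using unb by blast
    have sk: "s k powr \<alpha> n \<ge> 1" for n
      using s_gt_1[of k] alpha_pos[of n] by (simp add: ge_one_powr_ge_zero)
    \<comment> \<open>\<open>t\<close> exceeds \<open>ln (s k)\<close> from \<open>n0\<close> on; before \<open>n0\<close> there are only finitely many terms\<close>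
    have "w n * s k powr \<alpha> n \<le> s k powr \<alpha> n0" for n
    proof (cases "n \<ge> n0")
      case True
      have "ln (s k) \<le> t n" using n0 t_ge[OF True] by simp
      then have "ln (s k) * \<alpha> n \<le> t n * \<alpha> n" using alpha_pos[of n] by (intro mult_right_mono) auto
      then have "w n * s k powr \<alpha> n \<le> 1"
        using s_gt_1[of k] by (simp add: w_def powr_def mult_exp_exp algebra_simps)
      then show ?thesis using sk[of n0] by linarith
    next
      case False
      have "w n \<le> 1" using t0[of n] alpha_pos[of n] by (simp add: w_def)
      then have "w n * s k powr \<alpha> n \<le> 1 * s k powr \<alpha> n" by (intro mult_right_mono) auto
      also have "\<dots> \<le> s k powr \<alpha> n0"
        using False s_gt_1[of k] alpha_le[of n n0] by (simp add: powr_mono)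
      finally show ?thesis .
    qed
    then have "w n * (s k powr \<alpha> n * v k n) \<le> s k powr \<alpha> n0 * v k n" for n
      using step.pos[of k n] by (metis mult.assoc mult_right_mono less_imp_le)
    then have "w n \<le> s k powr \<alpha> n0 * v k n" for n
      using weight_mult[of k n] by (metis mult.commute mult.right_neutral)
    then show ?thesis by blast
  qed
  have incl: "c0 (v k) \<subseteq> c0 w" "\<exists>C. \<forall>x\<in>c0 (v k). c0_norm w x \<le> C * c0_norm (v k) x" for k
    using wD[of k] c0_mono[OF step.positive_weight_axioms w.positive_weight_axioms] by blast+
  define p where "p = c0_norm w"
  have "E \<subseteq> c0 w" using incl unfolding E_def by blast
  then have sp: "seminorm_on E p" unfolding p_def using w.seminorm seminorm_on_subset by blast
  then have p: "continuous_seminorm (E_space \<alpha> s) p"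
    unfolding p_def using incl continuous_seminorm_E_space_iff by blast
  obtain q where q: "continuous_seminorm (E_space \<alpha> s) q"
    and qn: "nuclear_map_on (cauchy_seqs E q) (completed_seminorm q)
           (cauchy_seqs E p) (completed_seminorm p) (\<lambda>\<xi>. \<xi>)"
    using nuc p unfolding nuclear_space_def topspace_E_space by blast
  have sq: "seminorm_on E q" and "\<exists>C. \<forall>x\<in>c0 (v 0). q x \<le> C * c0_norm (v 0) x"
    using q continuous_seminorm_E_space_iff by blast+
  then obtain C0 where "\<And>x. x \<in> c0 (v 0) \<Longrightarrow> q x \<le> C0 * c0_norm (v 0) x" by blast
  define C where "C = \<bar>C0\<bar>"
  have C: "q x \<le> C * c0_norm (v 0) x" if "x \<in> c0 (v 0)" for x
  proof -
    have "0 \<le> c0_norm (v 0) x" using step.seminorm that unfolding seminorm_on_def by blast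
    then have "C0 * c0_norm (v 0) x \<le> C * c0_norm (v 0) x" unfolding C_def by (intro mult_right_mono) auto
    then show ?thesis using \<open>\<And>x. x \<in> c0 (v 0) \<Longrightarrow> q x \<le> C0 * c0_norm (v 0) x\<close>[OF that] by linarith
  qed
  obtain L where L: "0 \<le> L" and trace: "\<And>(e :: nat \<Rightarrow> nat \<Rightarrow> complex) f c D B. finite B \<Longrightarrow> (\<And>n. n \<in> B \<Longrightarrow> e n \<in> E) \<Longrightarrow>
      (\<And>n. n \<in> B \<Longrightarrow> linear_map_on E (f n)) \<Longrightarrow> (\<And>n. n \<in> B \<Longrightarrow> 0 < c n) \<Longrightarrow>
      (\<And>n x. n \<in> B \<Longrightarrow> x \<in> E \<Longrightarrow> cmod (f n x) \<le> c n * p x) \<Longrightarrow>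
      (\<And>z. (\<And>n. n \<in> B \<Longrightarrow> cmod (z n) \<le> c n) \<Longrightarrow> q (\<Sum>n\<in>B. z n *\<^sub>C e n) \<le> D) \<Longrightarrow>
      cmod (\<Sum>n\<in>B. f n (e n)) \<le> L * D"
    using nuclear_map_trace_bound[OF csubspace_E sp sq qn] by blast
  have bound: "real (N + 1) \<le> L * (C * exp (t N * \<alpha> N))" for N
  proof -
    have "cmod (\<Sum>n\<in>{..N}. unit_seq n n) \<le> L * (C * exp (t N * \<alpha> N))"
    proof (rule trace[of "{..N}" unit_seq "\<lambda>n x. x n" "\<lambda>n. exp (t n * \<alpha> n)"])
      show "linear_map_on E (\<lambda>x. x n)" for n by (simp add: linear_map_on_def scaleC_complex_def)
      show "cmod (x n) \<le> exp (t n * \<alpha> n) * p x" if "x \<in> E" for n x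
      proof -
        have "w n * cmod (x n) \<le> p x" using c0_norm_upper that \<open>E \<subseteq> c0 w\<close> unfolding p_def by blast
        then have "exp (t n * \<alpha> n) * (w n * cmod (x n)) \<le> exp (t n * \<alpha> n) * p x" by (intro mult_left_mono) auto
        moreover have "exp (t n * \<alpha> n) * w n = 1" by (simp add: w_def exp_minus_inverse)
        ultimately show ?thesis by (metis mult.assoc mult_1)
      qed
      fix z :: "nat \<Rightarrow> complex" assume z: "\<And>n. n \<in> {..N} \<Longrightarrow> cmod (z n) \<le> exp (t n * \<alpha> n)"
      let ?x = "\<Sum>n\<in>{..N}. z n *\<^sub>C unit_seq n"
      have mem: "?x \<in> c0 (v 0)"
        using step.unit_seq(1) by (intro complex_vector.subspace_sum[OF step.csubspace_c0]
            complex_vector.subspace_scale[OF step.csubspace_c0])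
      have "c0_norm (v 0) ?x \<le> exp (t N * \<alpha> N)"
      proof (rule c0_norm_least[OF mem])
        fix n
        show "v 0 n * cmod (?x n) \<le> exp (t N * \<alpha> N)"
        proof (cases "n \<le> N")
          case True
          have "v 0 n \<le> 1"
            using s_gt_1[of 0] alpha_pos[of n] by (simp add: weight_def powr_minus ge_one_powr_ge_zero inverse_le_1_iff)
          then have "v 0 n * cmod (z n) \<le> 1 * exp (t n * \<alpha> n)"
            using z[of n] True by (intro mult_mono) auto
          also have "t n * \<alpha> n \<le> t N * \<alpha> N"
            using True t_mono alpha_le t0 alpha_pos by (intro mult_mono) (auto simp: less_imp_le)
          then have "1 * exp (t n * \<alpha> n) \<le> exp (t N * \<alpha> N)" by simp
          finally show ?thesis using True by (simp add: unit_seq_combination)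
        qed (simp add: unit_seq_combination)
      qed
      then have "C * c0_norm (v 0) ?x \<le> C * exp (t N * \<alpha> N)" by (intro mult_left_mono) (auto simp: C_def)
      then show "q ?x \<le> C * exp (t N * \<alpha> N)" using C[OF mem] by linarith
    qed (auto simp: unit_seq_in_E)
    moreover have "(\<Sum>n\<in>{..N}. unit_seq n n) = of_nat (N + 1)" by (simp add: unit_seq_def)
    ultimately show ?thesis by (metis norm_of_nat)
  qed
  obtain N :: nat where N: "real N \<ge> (L * C)\<^sup>2" using real_arch_simple by blast
  obtain n where n: "n \<ge> N" "\<And>m. m \<le> n \<Longrightarrow> g m \<le> g n" using exists_record[of g N] unb by blast
  have "t n = g n / 2" unfolding t_def using n(2) by (subst Max_eqI[of _ "g n"]) auto
  then have "t n * \<alpha> n = ln (real (n + 1)) / 2" using alpha_pos[of n] by (simp add: g_def)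
  then have "exp (t n * \<alpha> n) = sqrt (real (n + 1))"
    by (simp add: ln_sqrt[symmetric])
  then have "sqrt (real (n + 1)) * sqrt (real (n + 1)) \<le> (L * C) * sqrt (real (n + 1))"
    using bound[of n] by (simp add: mult.assoc)
  then have "sqrt (real (n + 1)) \<le> L * C" by (rule mult_right_le_imp_le) simp
  then have "(sqrt (real (n + 1)))\<^sup>2 \<le> (L * C)\<^sup>2" by (intro power_mono) auto
  then show False using N n(1) by simp
qed

lemma nuclear_iff_log_dominated: "nuclear_space (E_space \<alpha> s) \<longleftrightarrow> log_dominated"
  using log_dominated_imp_nuclear nuclear_imp_log_dominated by blast

end

theorem corollary2p10:
  fixes \<alpha> s :: "nat \<Rightarrow> real"
  assumes "\<And>n. \<alpha> n > 0" and "strict_mono \<alpha>" and "filterlim \<alpha> at_top sequentially"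
    and "\<And>k. s k > 1" and "strict_mono s" and "filterlim s at_top sequentially"
  shows "(nuclear_space (E_space \<alpha> s) \<longleftrightarrow>
            spectrum (E_space \<alpha> s) cesaro = point_spectrum (E_space \<alpha> s) cesaro) \<and>
         (spectrum (E_space \<alpha> s) cesaro = point_spectrum (E_space \<alpha> s) cesaro \<longleftrightarrow>
            spectrum (E_space \<alpha> s) cesaro = {1 / of_nat n | n :: nat. n \<ge> 1})"
proof -
  interpret power_series_dual \<alpha> s using assms by unfold_locales
  show ?thesis
    using nuclear_iff_log_dominated spectrum_eq_point_spectrum_iff spectrum_eq_reciprocals_iff by blast
qed

end
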